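(* Let $X$ and $Y$ be Banach spaces, let $p,q,r\in[1,+\infty)$ satisfy $\frac1q=\frac1p+\frac1r$, and let $f:\mathbb{R}\times X\to Y$ be a map. Put $\mathcal{N}_f(u)(t)=f(t,u(t))$ for $u:\mathbb{R}\to X$, $t\in\mathbb{R}$. Suppose that there exists $L\in BS^r(\mathbb{R})$ such that for a.e. $t\in\mathbb{R}$ and all $x_1,x_2\in X$, $\|f(t,x_1)-f(t,x_2)\|\le L(t)\|x_1-x_2\|$. Then: (i) If $f(\cdot,x)\in S^q_{aa}(\mathbb{R},Y)$ for all $x\in X$, then $\mathcal{N}_f$ maps $S^p_{aa}(\mathbb{R},X)$ into $S^q_{aa}(\mathbb{R},Y)$ and $\mathcal{N}_f:S^p_{aa}(\mathbb{R},X)\to S^q_{aa}(\mathbb{R},Y)$ is continuous. (ii) If $f(\cdot,x)\in S^q_{ap}(\mathbb{R},Y)$ for all $x\in X$, then $\mathcal{N}_f$ maps $S^p_{ap}(\mathbb{R},X)$ into $S^q_{ap}(\mathbb{R},Y)$ and $\mathcal{N}_f:S^p_{ap}(\mathbb{R},X)\to S^q_{ap}(\mathbb{R},Y)$ is continuous.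
   Context: For a Banach space $E$ and $1\le p<\infty$: $L^p(a,b;E)$ is the space of Bochner $p$-integrable functions on $(a,b)$ (functions equal a.e. are identified), and $L^p_{loc}(\mathbb{R},E)$ is the space of functions $u:\mathbb{R}\to E$ whose restriction to every bounded interval is in $L^p$ of that interval. The Bochner transform of $u\in L^p_{loc}(\mathbb{R},E)$ is the (continuous) map $u^b:\mathbb{R}\to L^p(0,1;E)$, $u^b(t)(\theta)=u(t+\theta)$, $\theta\in(0,1)$. $BC(\mathbb{R},E)$ is the space of bounded continuous maps $\mathbb{R}\to E$. A continuous function $u:\mathbb{R}\to E$ is almost periodic (in the sense of Bohr) if for each $\varepsilon>0$ the set $\{\tau\in\mathbb{R}:\sup_{t\in\mathbb{R}}\|u(t+\tau)-u(t)\|\le\varepsilon\}$ is relatively dense in $\mathbb{R}$ (meets every interval of some fixed length); the space of such functions is $AP(\mathbb{R},E)$. A continuous function $u:\mathbb{R}\to E$ is almost automorphic if every sequence of real numbers has a subsequence $(t_k)$ for which there is a function $v:\mathbb{R}\to E$ with $\lim_k u(t+t_k)=v(t)$ and $\lim_k v(t-t_k)=u(t)$ for every $t\in\mathbb{R}$; the space of such functions is $AA(\mathbb{R},E)$. $BS^p(\mathbb{R},E)$, $S^p_{aa}(\mathbb{R},E)$, $S^p_{ap}(\mathbb{R},E)$ are the spaces of $u\in L^p_{loc}(\mathbb{R},E)$ such that $u^b$ belongs to $BC(\mathbb{R},L^p(0,1;E))$, $AA(\mathbb{R},L^p(0,1;E))$, $AP(\mathbb{R},L^p(0,1;E))$ respectively;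 they are Banach spaces with the norm $\|u\|_{S^p}=\sup_{t\in\mathbb{R}}\left(\int_0^1\|u(t+\theta)\|^p\,d\theta\right)^{1/p}$. We write $BS^r(\mathbb{R})$ for $BS^r(\mathbb{R},\mathbb{R})$. *)

theory Defs
  imports "HOL-Analysis.Analysis"
begin

section \<open>The spaces $L^p(a,b;E)$\<close>

text \<open>Strong (Bochner) measurability up to null sets.  Borel measurability alone would be too weak,
  since \<open>E\<close> is not assumed to be separable; for the same reason the library's Bochner integral,
  which is restricted to second countable spaces, is used for real-valued integrands only.\<close>

definition bochner_measurable :: "real \<Rightarrow> real \<Rightarrow> (real \<Rightarrow> 'e::banach) \<Rightarrow> bool" where
  "bochner_measurable a b f \<longleftrightarrow>
     (\<exists>s. (\<forall>i. simple_function (lebesgue_on {a<..<b}) (s i)) \<and>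
          (AE x in lebesgue_on {a<..<b}. (\<lambda>i::nat. s i x) \<longlonglongrightarrow> f x))"

text \<open>The functions representing elements of $L^p(a,b;E)$; their values outside \<open>(a,b)\<close> are
  irrelevant.\<close>

definition Lp_fun :: "real \<Rightarrow> real \<Rightarrow> real \<Rightarrow> (real \<Rightarrow> 'e::banach) set" where
  "Lp_fun p a b = {f. bochner_measurable a b f \<and>
                      integrable (lebesgue_on {a<..<b}) (\<lambda>x. norm (f x) powr p)}"

definition Lp_norm :: "real \<Rightarrow> real \<Rightarrow> real \<Rightarrow> (real \<Rightarrow> 'e::banach) \<Rightarrow> real" where
  "Lp_norm p a b f = (integral\<^sup>L (lebesgue_on {a<..<b}) (\<lambda>x. norm (f x) powr p)) powr (1 / p)"

definition Lp_class :: "real \<Rightarrow> real \<Rightarrow> real \<Rightarrow> (real \<Rightarrow> 'e::banach) \<Rightarrow> (real \<Rightarrow> 'e) set" where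
  "Lp_class p a b f = {g \<in> Lp_fun p a b. AE x in lebesgue_on {a<..<b}. g x = f x}"

text \<open>The metric $\|F - G\|$ on classes, computed on representatives; see \<open>mdist_Lp_metric\<close> below for
  independence of the choice.\<close>

definition Lp_dist :: "real \<Rightarrow> real \<Rightarrow> real \<Rightarrow> (real \<Rightarrow> 'e::banach) set \<Rightarrow> (real \<Rightarrow> 'e) set \<Rightarrow> real" where
  "Lp_dist p a b F G = Lp_norm p a b (\<lambda>x. (SOME f. f \<in> F) x - (SOME g. g \<in> G) x)"

definition Lp_metric :: "real \<Rightarrow> real \<Rightarrow> real \<Rightarrow> (real \<Rightarrow> 'e::banach) set metric" where
  "Lp_metric p a b = metric (Lp_class p a b ` Lp_fun p a b, Lp_dist p a b)"

lemma complete_measure_interval: "complete_measure (lebesgue_on {a<..<b::real})"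
proof
  fix B A :: "real set"
  assume "B \<subseteq> A" "A \<in> null_sets (lebesgue_on {a<..<b})"
  then have "A \<in> null_sets lebesgue" "A \<subseteq> {a<..<b}"
    by (auto simp: null_sets_restrict_space)
  with \<open>B \<subseteq> A\<close> show "B \<in> sets (lebesgue_on {a<..<b})"
    using completion.complete2[of B A lborel]
    by (auto simp: sets_restrict_space_iff)
qed

lemma bochner_measurable_imp_borel:
  fixes f :: "real \<Rightarrow> 'e::banach"
  assumes "bochner_measurable a b f"
  shows "f \<in> borel_measurable (lebesgue_on {a<..<b})"
proof -
  interpret complete_measure "lebesgue_on {a<..<b}" by (rule complete_measure_interval)
  let ?M = "lebesgue_on {a<..<b}"
  obtain s where s: "\<And>i. simple_function ?M (s i)"
    and lim: "AE x in ?M. (\<lambda>i::nat. s i x) \<longlonglongrightarrow> f x"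
    using assms unfolding bochner_measurable_def by blast
  from lim obtain N where N: "N \<in> null_sets ?M" "{x \<in> space ?M. \<not> (\<lambda>i. s i x) \<longlonglongrightarrow> f x} \<subseteq> N"
    by (elim AE_E) (blast intro: null_setsI)
  define g where "g x = (if x \<in> N then 0 else f x)" for x
  have g: "g \<in> borel_measurable ?M"
  proof (rule borel_measurable_LIMSEQ_metric)
    show "(\<lambda>x. if x \<in> N then 0 else s i x) \<in> borel_measurable ?M" for i
      using N(1) borel_measurable_simple_function[OF s[of i]]
      by (intro measurable_If_set) (auto simp: null_sets_def)
    show "(\<lambda>i. if x \<in> N then 0 else s i x) \<longlonglongrightarrow> g x" if "x \<in> space ?M" for x
      using that N(2) by (auto simp: g_def)
  qed
  show ?thesis
  proof (rule measurableI)
    fix A :: "'e set" assume A: "A \<in> sets borel"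
    have 1: "g -` A \<inter> space ?M - N \<in> sets ?M"
      using measurable_sets[OF g A] N(1) by (intro sets.Diff) auto
    have 2: "f -` A \<inter> space ?M \<inter> N \<in> sets ?M"
      using complete2[OF _ N(1), of "f -` A \<inter> space ?M \<inter> N"] by auto
    have "f -` A \<inter> space ?M = (g -` A \<inter> space ?M - N) \<union> (f -` A \<inter> space ?M \<inter> N)"
      by (auto simp: g_def split: if_splits)
    with 1 2 show "f -` A \<inter> space ?M \<in> sets ?M" by (metis sets.Un)
  qed auto
qed

lemma bochner_measurable_diff:
  assumes "bochner_measurable a b f" "bochner_measurable a b g"
  shows "bochner_measurable a b (\<lambda>x. f x - g x)"
proof -
  obtain s where s: "\<And>i. simple_function (lebesgue_on {a<..<b}) (s i)"
    "AE x in lebesgue_on {a<..<b}. (\<lambda>i::nat. s i x) \<longlonglongrightarrow> f x"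
    using assms(1) unfolding bochner_measurable_def by blast
  obtain t where t: "\<And>i. simple_function (lebesgue_on {a<..<b}) (t i)"
    "AE x in lebesgue_on {a<..<b}. (\<lambda>i::nat. t i x) \<longlonglongrightarrow> g x"
    using assms(2) unfolding bochner_measurable_def by blast
  show ?thesis
    unfolding bochner_measurable_def
  proof (intro exI[of _ "\<lambda>i x. s i x - t i x"] conjI allI)
    show "simple_function (lebesgue_on {a<..<b}) (\<lambda>x. s i x - t i x)" for i
      using s(1)[of i] t(1)[of i] by (rule simple_function_diff)
    show "AE x in lebesgue_on {a<..<b}. (\<lambda>i. s i x - t i x) \<longlonglongrightarrow> f x - g x"
      using s(2) t(2) by eventually_elim (rule tendsto_diff)
  qed
qed

lemma powr_add_le:
  fixes x y p :: real
  assumes "0 \<le> x" "0 \<le> y" "1 \<le> p"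
  shows "(x + y) powr p \<le> 2 powr p * (x powr p + y powr p)"
proof -
  have "(x + y) powr p \<le> (2 * max x y) powr p"
    using assms by (intro powr_mono2) auto
  also have "\<dots> = 2 powr p * max x y powr p"
    using assms by (simp add: powr_mult)
  also have "\<dots> \<le> 2 powr p * (x powr p + y powr p)"
    by (intro mult_left_mono) (auto simp: max_def)
  finally show ?thesis .
qed

lemma Lp_fun_diff:
  fixes f g :: "real \<Rightarrow> 'e::banach"
  assumes p: "1 \<le> p" and f: "f \<in> Lp_fun p a b" and g: "g \<in> Lp_fun p a b"
  shows "(\<lambda>x. f x - g x) \<in> Lp_fun p a b"
proof -
  let ?M = "lebesgue_on {a<..<b}"
  have m: "bochner_measurable a b (\<lambda>x. f x - g x)"
    using f g by (auto simp: Lp_fun_def intro: bochner_measurable_diff)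
  have "integrable ?M (\<lambda>x. 2 powr p * (norm (f x) powr p + norm (g x) powr p))"
    using f g by (auto simp: Lp_fun_def)
  moreover have "(\<lambda>x. norm (f x - g x) powr p) \<in> borel_measurable ?M"
    using bochner_measurable_imp_borel[OF m] by measurable
  moreover have "norm (f x - g x) powr p \<le> 2 powr p * (norm (f x) powr p + norm (g x) powr p)" for x
  proof -
    have "norm (f x - g x) powr p \<le> (norm (f x) + norm (g x)) powr p"
      using p by (intro powr_mono2 norm_triangle_ineq4) auto
    then show ?thesis using powr_add_le[of "norm (f x)" "norm (g x)" p] p by simp
  qed
  ultimately have "integrable ?M (\<lambda>x. norm (f x - g x) powr p)"
    by (elim Bochner_Integration.integrable_bound) (auto simp: abs_of_nonneg)
  with m show ?thesis by (simp add: Lp_fun_def)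
qed

lemma powr_convex_nonneg:
  fixes x y u p :: real
  assumes "1 \<le> p" "0 \<le> x" "0 \<le> y" "0 \<le> u" "u \<le> 1"
  shows "(u * x + (1 - u) * y) powr p \<le> u * x powr p + (1 - u) * y powr p"
proof -
  have le: "c powr p \<le> c" if "0 \<le> c" "c \<le> 1" for c :: real
    using powr_mono'[of 1 p c] that assms(1) by simp
  consider "x = 0" | "y = 0" | "0 < x" "0 < y" using assms by linarith
  then show ?thesis
  proof cases
    case 1
    then show ?thesis using le[of "1 - u"] assms by (simp add: powr_mult mult_right_mono)
  next
    case 2
    then show ?thesis using le[of u] assms by (simp add: powr_mult mult_right_mono)
  next
    case 3
    then show ?thesis
      using convex_onD[OF powr_convex[OF assms(1)], of "1 - u" x y] assms by simp
  qed
qed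

lemma Lp_norm_minkowski:
  fixes f g h :: "real \<Rightarrow> 'e::banach"
  assumes p: "1 \<le> p" and f: "f \<in> Lp_fun p a b" and g: "g \<in> Lp_fun p a b" and h: "h \<in> Lp_fun p a b"
  shows "Lp_norm p a b (\<lambda>x. f x - h x) \<le>
         Lp_norm p a b (\<lambda>x. f x - g x) + Lp_norm p a b (\<lambda>x. g x - h x)"
proof (rule field_le_epsilon)
  fix e :: real assume e: "0 < e"
  let ?M = "lebesgue_on {a<..<b}"
  let ?A = "Lp_norm p a b (\<lambda>x. f x - g x)" and ?B = "Lp_norm p a b (\<lambda>x. g x - h x)"
  let ?I = "\<lambda>F. integral\<^sup>L ?M (\<lambda>x. norm (F x) powr p)"
  define A where "A = ?A + e / 2"
  define B where "B = ?B + e / 2"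
  have A: "0 < A" "?A \<le> A" and B: "0 < B" "?B \<le> B"
    using e by (auto simp: A_def B_def Lp_norm_def add_nonneg_pos)
  define u where "u = A / (A + B)"
  have u: "0 \<le> u" "u \<le> 1" "1 - u = B / (A + B)"
    using A B by (auto simp: u_def field_simps)
  have int: "integrable ?M (\<lambda>x. norm (f x - g x) powr p)" "integrable ?M (\<lambda>x. norm (g x - h x) powr p)"
    "integrable ?M (\<lambda>x. norm (f x - h x) powr p)"
    using Lp_fun_diff[OF p] f g h by (auto simp: Lp_fun_def)
  have norm_p: "?I F \<le> C powr p" if "Lp_norm p a b F \<le> C" for F :: "real \<Rightarrow> 'e" and C
  proof -
    have "?I F = Lp_norm p a b F powr p"
      using p by (simp add: Lp_norm_def powr_powr)
    also have "\<dots> \<le> C powr p"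
      using that p by (intro powr_mono2) (auto simp: Lp_norm_def)
    finally show ?thesis .
  qed
  have pw: "norm (f x - h x) powr p \<le> (A + B) powr p *
      (u * (norm (f x - g x) powr p / A powr p) + (1 - u) * (norm (g x - h x) powr p / B powr p))" for x
  proof -
    have "norm (f x - h x) \<le> norm (f x - g x) + norm (g x - h x)"
      using norm_triangle_ineq[of "f x - g x" "g x - h x"] by simp
    also have "\<dots> = (A + B) * (u * (norm (f x - g x) / A) + (1 - u) * (norm (g x - h x) / B))"
    proof -
      have "(A + B) * (u * (c / A)) = c" for c using A B by (simp add: u_def)
      moreover have "(A + B) * ((1 - u) * (c / B)) = c" for c using A B by (simp add: u(3))
      ultimately show ?thesis by (simp only: distrib_left)
    qed
    finally have "norm (f x - h x) powr p \<le>
      ((A + B) * (u * (norm (f x - g x) / A) + (1 - u) * (norm (g x - h x) / B))) powr p"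
      using p by (intro powr_mono2) auto
    also have "\<dots> = (A + B) powr p * (u * (norm (f x - g x) / A) + (1 - u) * (norm (g x - h x) / B)) powr p"
      by (simp only: powr_mult)
    also have "\<dots> \<le> (A + B) powr p *
      (u * (norm (f x - g x) / A) powr p + (1 - u) * (norm (g x - h x) / B) powr p)"
      using A B u p by (intro mult_left_mono powr_convex_nonneg) auto
    finally show ?thesis using A B by (simp add: powr_divide)
  qed
  have "?I (\<lambda>x. f x - h x) \<le> (\<integral>x. (A + B) powr p *
      (u * (norm (f x - g x) powr p / A powr p) + (1 - u) * (norm (g x - h x) powr p / B powr p)) \<partial>?M)"
    using int pw by (intro integral_mono) auto
  also have "\<dots> = (A + B) powr p * (u * (?I (\<lambda>x. f x - g x) / A powr p) + (1 - u) * (?I (\<lambda>x. g x - h x) / B powr p))"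
    using int by simp
  also have "\<dots> \<le> (A + B) powr p * (u * 1 + (1 - u) * 1)"
    using norm_p[OF A(2)] norm_p[OF B(2)] A B u
    by (intro mult_left_mono add_mono) auto
  finally have "?I (\<lambda>x. f x - h x) \<le> (A + B) powr p" by simp
  then have "Lp_norm p a b (\<lambda>x. f x - h x) \<le> ((A + B) powr p) powr (1 / p)"
    unfolding Lp_norm_def using p by (intro powr_mono2) auto
  also have "\<dots> = A + B" using A B p by (simp add: powr_powr)
  finally show "Lp_norm p a b (\<lambda>x. f x - h x) \<le> ?A + ?B + e"
    by (simp add: A_def B_def)
qed

lemma Lp_norm_cong_AE:
  assumes "f \<in> Lp_fun p a b" "g \<in> Lp_fun p a b" "AE x in lebesgue_on {a<..<b}. f x = g x"
  shows "Lp_norm p a b f = Lp_norm p a b g"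
proof -
  have "integral\<^sup>L (lebesgue_on {a<..<b}) (\<lambda>x. norm (f x) powr p) =
        integral\<^sup>L (lebesgue_on {a<..<b}) (\<lambda>x. norm (g x) powr p)"
    using assms by (intro integral_cong_AE) (auto simp: Lp_fun_def)
  then show ?thesis by (simp add: Lp_norm_def)
qed

lemma Lp_dist_class:
  fixes f g :: "real \<Rightarrow> 'e::banach"
  assumes p: "1 \<le> p" and f: "f \<in> Lp_fun p a b" and g: "g \<in> Lp_fun p a b"
  shows "Lp_dist p a b (Lp_class p a b f) (Lp_class p a b g) = Lp_norm p a b (\<lambda>x. f x - g x)"
proof -
  define f' where "f' = (SOME k. k \<in> Lp_class p a b f)"
  define g' where "g' = (SOME k. k \<in> Lp_class p a b g)"
  have "f \<in> Lp_class p a b f" "g \<in> Lp_class p a b g"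
    using f g by (simp_all add: Lp_class_def)
  then have "f' \<in> Lp_class p a b f" "g' \<in> Lp_class p a b g"
    unfolding f'_def g'_def by (simp_all only: someI[where P = "\<lambda>k. k \<in> Lp_class p a b f"]
      someI[where P = "\<lambda>k. k \<in> Lp_class p a b g"])
  then have *: "f' \<in> Lp_fun p a b" "g' \<in> Lp_fun p a b"
    "AE x in lebesgue_on {a<..<b}. f' x = f x" "AE x in lebesgue_on {a<..<b}. g' x = g x"
    by (auto simp: Lp_class_def)
  have "AE x in lebesgue_on {a<..<b}. f' x - g' x = f x - g x"
    using *(3,4) by eventually_elim simp
  then have "Lp_norm p a b (\<lambda>x. f' x - g' x) = Lp_norm p a b (\<lambda>x. f x - g x)"
    using Lp_fun_diff[OF p] f g * by (intro Lp_norm_cong_AE) auto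
  then show ?thesis by (simp add: Lp_dist_def f'_def g'_def)
qed

lemma Lp_norm_eq_0_iff:
  assumes p: "1 \<le> p" and f: "f \<in> Lp_fun p a b"
  shows "Lp_norm p a b f = 0 \<longleftrightarrow> (AE x in lebesgue_on {a<..<b}. f x = 0)"
proof -
  have "Lp_norm p a b f = 0 \<longleftrightarrow> integral\<^sup>L (lebesgue_on {a<..<b}) (\<lambda>x. norm (f x) powr p) = 0"
    using p by (simp add: Lp_norm_def)
  also have "\<dots> \<longleftrightarrow> (AE x in lebesgue_on {a<..<b}. norm (f x) powr p = 0)"
    using f by (intro integral_nonneg_eq_0_iff_AE) (auto simp: Lp_fun_def)
  finally show ?thesis by simp
qed

lemma Metric_space_Lp:
  assumes p: "1 \<le> p"
  shows "Metric_space (Lp_class p a b ` Lp_fun p a b :: (real \<Rightarrow> 'e::banach) set set) (Lp_dist p a b)"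
proof
  show "0 \<le> Lp_dist p a b F G" for F G :: "(real \<Rightarrow> 'e) set"
    by (simp add: Lp_dist_def Lp_norm_def)
  show "Lp_dist p a b F G = Lp_dist p a b G F" for F G :: "(real \<Rightarrow> 'e) set"
    by (simp add: Lp_dist_def Lp_norm_def norm_minus_commute)
next
  fix F G :: "(real \<Rightarrow> 'e) set"
  assume "F \<in> Lp_class p a b ` Lp_fun p a b" "G \<in> Lp_class p a b ` Lp_fun p a b"
  then obtain f g where fg: "F = Lp_class p a b f" "G = Lp_class p a b g"
    "f \<in> Lp_fun p a b" "g \<in> Lp_fun p a b" by blast
  have "Lp_dist p a b F G = 0 \<longleftrightarrow> (AE x in lebesgue_on {a<..<b}. f x = g x)"
    using fg Lp_norm_eq_0_iff[OF p Lp_fun_diff[OF p fg(3,4)]] by (simp add: Lp_dist_class p)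
  also have "\<dots> \<longleftrightarrow> F = G"
  proof
    assume eq: "AE x in lebesgue_on {a<..<b}. f x = g x"
    have "(AE x in lebesgue_on {a<..<b}. k x = f x) \<longleftrightarrow> (AE x in lebesgue_on {a<..<b}. k x = g x)" for k
      by (rule eventually_cong[OF eq]) simp
    then show "F = G" by (simp add: fg Lp_class_def)
  next
    assume "F = G"
    moreover have "f \<in> Lp_class p a b f" using fg by (simp add: Lp_class_def)
    ultimately show "AE x in lebesgue_on {a<..<b}. f x = g x" by (simp add: fg Lp_class_def)
  qed
  finally show "Lp_dist p a b F G = 0 \<longleftrightarrow> F = G" .
next
  fix F G H :: "(real \<Rightarrow> 'e) set"
  assume "F \<in> Lp_class p a b ` Lp_fun p a b" "G \<in> Lp_class p a b ` Lp_fun p a b"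
    "H \<in> Lp_class p a b ` Lp_fun p a b"
  then show "Lp_dist p a b F H \<le> Lp_dist p a b F G + Lp_dist p a b G H"
    using Lp_norm_minkowski[OF p] by (auto simp: Lp_dist_class p)
qed

lemma mspace_Lp_metric:
  "1 \<le> p \<Longrightarrow> mspace (Lp_metric p a b) = Lp_class p a b ` Lp_fun p a b"
  unfolding Lp_metric_def by (rule Metric_space.mspace_metric[OF Metric_space_Lp])

lemma mdist_Lp_metric:
  assumes "1 \<le> p" "f \<in> Lp_fun p a b" "g \<in> Lp_fun p a b"
  shows "mdist (Lp_metric p a b) (Lp_class p a b f) (Lp_class p a b g) = Lp_norm p a b (\<lambda>x. f x - g x)"
  using assms by (simp add: Lp_metric_def Metric_space.mdist_metric[OF Metric_space_Lp] Lp_dist_class)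


section \<open>Bounded continuous, almost periodic and almost automorphic functions\<close>

definition BC :: "'e metric \<Rightarrow> (real \<Rightarrow> 'e) set" where
  "BC m = {u. continuous_map euclidean (mtopology_of m) u \<and>
              Metric_space.mbounded (mspace m) (mdist m) (range u)}"

definition relatively_dense :: "real set \<Rightarrow> bool" where
  "relatively_dense S \<longleftrightarrow> (\<exists>l>0. \<forall>a. {a..a + l} \<inter> S \<noteq> {})"

definition AP :: "'e metric \<Rightarrow> (real \<Rightarrow> 'e) set" where
  "AP m = {u. continuous_map euclidean (mtopology_of m) u \<and>
              (\<forall>\<epsilon>>0. relatively_dense {\<tau>. \<forall>t. mdist m (u (t + \<tau>)) (u t) \<le> \<epsilon>})}"

definition AA :: "'e metric \<Rightarrow> (real \<Rightarrow> 'e) set" where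
  "AA m = {u. continuous_map euclidean (mtopology_of m) u \<and>
              (\<forall>s :: nat \<Rightarrow> real. \<exists>\<phi> v. strict_mono (\<phi> :: nat \<Rightarrow> nat) \<and>
                 (\<forall>t. limitin (mtopology_of m) (\<lambda>k. u (t + s (\<phi> k))) (v t) sequentially \<and>
                      limitin (mtopology_of m) (\<lambda>k. v (t - s (\<phi> k))) (u t) sequentially))}"


section \<open>Stepanov spaces\<close>

definition Lp_loc :: "real \<Rightarrow> (real \<Rightarrow> 'e::banach) set" where
  "Lp_loc p = {u. \<forall>a b. u \<in> Lp_fun p a b}"

definition bochner_transform :: "real \<Rightarrow> (real \<Rightarrow> 'e::banach) \<Rightarrow> real \<Rightarrow> (real \<Rightarrow> 'e) set" where
  "bochner_transform p u t = Lp_class p 0 1 (\<lambda>\<theta>. u (t + \<theta>))"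

definition BSp :: "real \<Rightarrow> (real \<Rightarrow> 'e::banach) set" where
  "BSp p = {u \<in> Lp_loc p. bochner_transform p u \<in> BC (Lp_metric p 0 1)}"

definition Sp_aa :: "real \<Rightarrow> (real \<Rightarrow> 'e::banach) set" where
  "Sp_aa p = {u \<in> Lp_loc p. bochner_transform p u \<in> AA (Lp_metric p 0 1)}"

definition Sp_ap :: "real \<Rightarrow> (real \<Rightarrow> 'e::banach) set" where
  "Sp_ap p = {u \<in> Lp_loc p. bochner_transform p u \<in> AP (Lp_metric p 0 1)}"

text \<open>The supremum is finite for \<open>u \<in> BSp p\<close>, hence also on \<open>Sp_aa p\<close> and \<open>Sp_ap p\<close>; outside
  \<open>BSp p\<close> the value of this real supremum carries no meaning.\<close>

definition Sp_norm :: "real \<Rightarrow> (real \<Rightarrow> 'e::banach) \<Rightarrow> real" where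
  "Sp_norm p u = (SUP t. Lp_norm p 0 1 (\<lambda>\<theta>. u (t + \<theta>)))"

text \<open>The Stepanov spaces above consist of functions rather than of classes modulo equality a.e.,
  so \<open>Sp_norm\<close> is a seminorm on them, vanishing exactly on the functions that are \<open>0\<close> a.e.
  Continuity for these seminorms is the same as continuity, in norm, of the induced map of classes;
  in particular it forces the map to respect equality a.e.\<close>

definition Sp_continuous_on ::
  "real \<Rightarrow> real \<Rightarrow> (real \<Rightarrow> 'x::banach) set \<Rightarrow> ((real \<Rightarrow> 'x) \<Rightarrow> (real \<Rightarrow> 'y::banach)) \<Rightarrow> bool" where
  "Sp_continuous_on p q U F \<longleftrightarrow>
     (\<forall>u\<in>U. \<forall>\<epsilon>>0. \<exists>\<delta>>0. \<forall>v\<in>U. Sp_norm p (\<lambda>t. v t - u t) < \<delta> \<longrightarrow>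
                                   Sp_norm q (\<lambda>t. F v t - F u t) < \<epsilon>)"

definition nemytskii :: "(real \<times> 'x \<Rightarrow> 'y) \<Rightarrow> (real \<Rightarrow> 'x) \<Rightarrow> real \<Rightarrow> 'y" where
  "nemytskii f u = (\<lambda>t. f (t, u t))"

end

(*
  By Hoelder's inequality N_f is Lipschitz from S^p to S^q with constant ||L||_{S^r}, so only the
  invariance of the classes is at stake.  Fix e > 0, approximate u^b(c) in L^p(0,1) by a simple
  function phi with values in a finite set D, and compare f(t + ., u(t + .)) with f(t + ., phi).  If
  u^b(a) and u^b(b) are close to u^b(c), then N_f(u)^b(a) and N_f(u)^b(b) are e-close as soon as
  f(., x)^b(a) and f(., x)^b(b) are close for the finitely many x in D.

  Almost periodicity: u^b has totally bounded range, so finitely many c suffice, and a common almost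
  period of u and of finitely many f(., x) is an e-almost period of N_f(u).  Almost automorphy: the
  range of u^b has a countable dense subset, so countably many x suffice, and a diagonal argument
  yields one subsequence that serves u and all these f(., x); the limit function exists since
  L^q(0,1) is complete.
*)

theory Submission
  imports Defs "HOL-Library.Diagonal_Subsequence"
begin

section \<open>Almost periodic and almost automorphic pseudometrics\<close>

text \<open>The obstacle is that each \<open>f (\<cdot>, x)\<close> is controlled separately, with
  nothing uniform in \<open>x\<close>, while a single window of \<open>u\<close> may take infinitely
  many values. The Lipschitz condition allows passing to finitely many values, but \<open>L\<close>
  is bounded only in mean over unit intervals, so all comparisons are made in integral norms. The
  order of quantifiers in \<open>controlled\<close> is decisive: \<open>\<eta>\<close> depends on
  \<open>e\<close> alone and can be fixed before any base point \<open>c\<close> is chosen, whereas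
  \<open>D\<close> and \<open>\<delta>\<close> come from the approximation at \<open>c\<close> and
  vary with it. Almost periodicity is uniform on the line, so a finite net of base points serves all
  \<open>t\<close>. Almost automorphy is pointwise: the base point suited to \<open>t\<close> is
  known only after the subsequence has been extracted, so all rational base points are provided for
  in advance.\<close>

text \<open>A curve in a metric space is represented by the pseudometric \<open>d s t\<close> that it induces on the
  real line: continuity, almost periodicity and (in a complete space) almost automorphy depend on
  nothing else.\<close>

locale line_pseudometric =
  fixes d :: "real \<Rightarrow> real \<Rightarrow> real"
  assumes refl0: "d s s = 0"
    and commute: "d s t = d t s"
    and triangle: "d s u \<le> d s t + d t u"

definition line_continuous :: "(real \<Rightarrow> real \<Rightarrow> real) \<Rightarrow> bool" where
  "line_continuous d \<longleftrightarrow> (\<forall>t. \<forall>e>0. \<exists>h>0. \<forall>s. \<bar>s - t\<bar> < h \<longrightarrow> d s t < e)"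

definition line_ap :: "(real \<Rightarrow> real \<Rightarrow> real) \<Rightarrow> bool" where
  "line_ap d \<longleftrightarrow> line_continuous d \<and> (\<forall>e>0. relatively_dense {\<tau>. \<forall>t. d (t + \<tau>) t \<le> e})"

text \<open>The second condition is $\lim_k \lim_j u(t - s_k + s_j) = u(t)$, with the inner limit, whose
  existence is the first condition, eliminated.\<close>

definition aa_sequence :: "(real \<Rightarrow> real \<Rightarrow> real) \<Rightarrow> (nat \<Rightarrow> real) \<Rightarrow> bool" where
  "aa_sequence d s \<longleftrightarrow>
     (\<forall>t. \<forall>e>0. \<exists>K. \<forall>j\<ge>K. \<forall>k\<ge>K. d (t + s j) (t + s k) < e) \<and>
     (\<forall>t. \<forall>e>0. \<exists>K. \<forall>k\<ge>K. \<exists>J. \<forall>j\<ge>J. d (t - s k + s j) t < e)"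

definition line_aa :: "(real \<Rightarrow> real \<Rightarrow> real) \<Rightarrow> bool" where
  "line_aa d \<longleftrightarrow> line_continuous d \<and>
     (\<forall>s. \<exists>\<phi>. strict_mono (\<phi> :: nat \<Rightarrow> nat) \<and> aa_sequence d (s \<circ> \<phi>))"

lemma line_continuousD:
  "line_continuous d \<Longrightarrow> 0 < e \<Longrightarrow> \<exists>h>0. \<forall>s. \<bar>s - t\<bar> < h \<longrightarrow> d s t < e"
  unfolding line_continuous_def by blast

section \<open>Extraction of common subsequences\<close>

lemma aa_sequence_subseq:
  assumes "aa_sequence d s" "strict_mono (\<phi> :: nat \<Rightarrow> nat)"
  shows "aa_sequence d (s \<circ> \<phi>)"
  unfolding aa_sequence_def
proof (intro conjI allI impI)
  fix t e :: real assume e: "0 < e"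
  have ge: "K \<le> \<phi> k" if "K \<le> k" for K k
    using seq_suble[OF assms(2), of k] that by simp
  obtain K where "\<forall>j\<ge>K. \<forall>k\<ge>K. d (t + s j) (t + s k) < e"
    using assms(1) e unfolding aa_sequence_def by blast
  then show "\<exists>K. \<forall>j\<ge>K. \<forall>k\<ge>K. d (t + (s \<circ> \<phi>) j) (t + (s \<circ> \<phi>) k) < e"
    using ge by (intro exI[of _ K]) auto
  obtain K where K: "\<forall>k\<ge>K. \<exists>J. \<forall>j\<ge>J. d (t - s k + s j) t < e"
    using assms(1) e unfolding aa_sequence_def by blast
  show "\<exists>K. \<forall>k\<ge>K. \<exists>J. \<forall>j\<ge>J. d (t - (s \<circ> \<phi>) k + (s \<circ> \<phi>) j) t < e"
  proof (rule exI[of _ K], intro allI impI)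
    fix k assume "K \<le> k"
    then obtain J where "\<forall>j\<ge>J. d (t - s (\<phi> k) + s j) t < e" using K ge by blast
    then show "\<exists>J. \<forall>j\<ge>J. d (t - (s \<circ> \<phi>) k + (s \<circ> \<phi>) j) t < e"
      using ge by (intro exI[of _ J]) auto
  qed
qed

text \<open>A diagonal sequence is a subsequence of the n-th extracted sequence only from some index
  on, so the property must be insensitive to a finite initial segment.\<close>

lemma aa_sequence_shift:
  assumes "aa_sequence d (\<lambda>k. s (k + n))"
  shows "aa_sequence d s"
  unfolding aa_sequence_def
proof (intro conjI allI impI)
  fix t e :: real assume e: "0 < e"
  obtain K where K: "\<forall>j\<ge>K. \<forall>k\<ge>K. d (t + s (j + n)) (t + s (k + n)) < e"
    using assms e unfolding aa_sequence_def by blast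
  have "d (t + s j) (t + s k) < e" if "K + n \<le> j" "K + n \<le> k" for j k
    using K[rule_format, of "j - n" "k - n"] that by simp
  then show "\<exists>K. \<forall>j\<ge>K. \<forall>k\<ge>K. d (t + s j) (t + s k) < e" by blast
  obtain K where K: "\<forall>k\<ge>K. \<exists>J. \<forall>j\<ge>J. d (t - s (k + n) + s (j + n)) t < e"
    using assms e unfolding aa_sequence_def by blast
  show "\<exists>K. \<forall>k\<ge>K. \<exists>J. \<forall>j\<ge>J. d (t - s k + s j) t < e"
  proof (rule exI[of _ "K + n"], intro allI impI)
    fix k assume k: "K + n \<le> k"
    then have "K \<le> k - n" "k - n + n = k" by auto
    then obtain J where J: "\<forall>j\<ge>J. d (t - s k + s (j + n)) t < e"
      using K by metis
    have "d (t - s k + s j) t < e" if "J + n \<le> j" for j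
      using J[rule_format, of "j - n"] that by simp
    then show "\<exists>J. \<forall>j\<ge>J. d (t - s k + s j) t < e" by blast
  qed
qed

text \<open>Diagonal extraction along an enumeration of \<open>I\<close>. The empty index set is
  treated apart because \<open>from_nat_into\<close> enumerates nonempty sets only.\<close>

lemma common_aa_subsequence:
  fixes d :: "'i \<Rightarrow> real \<Rightarrow> real \<Rightarrow> real"
  assumes "countable I" and aa: "\<And>i. i \<in> I \<Longrightarrow> line_aa (d i)"
  obtains \<phi> :: "nat \<Rightarrow> nat"
  where "strict_mono \<phi>" "\<And>i. i \<in> I \<Longrightarrow> aa_sequence (d i) (s \<circ> \<phi>)"
proof (cases "I = {}")
  case True
  then show thesis using that[of id] by (simp add: strict_mono_def)
next
  case False
  define P where "P n \<phi> \<longleftrightarrow> aa_sequence (d (from_nat_into I n)) (s \<circ> \<phi>)" for n and \<phi> :: "nat \<Rightarrow> nat"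
  interpret subseqs P
  proof
    fix n and \<phi> :: "nat \<Rightarrow> nat" assume "strict_mono \<phi>"
    have "line_aa (d (from_nat_into I n))" using aa from_nat_into[OF False] by blast
    then show "\<exists>r'. strict_mono r' \<and> P n (\<phi> \<circ> r')"
      unfolding line_aa_def P_def by (metis comp_assoc)
  qed
  show thesis
  proof (rule that)
    show "strict_mono diagseq" by (rule subseq_diagseq)
    fix i assume "i \<in> I"
    then obtain n where n: "i = from_nat_into I n"
      using from_nat_into_surj[OF assms(1)] by metis
    \<comment> \<open>Once its first \<open>Suc n\<close> terms are dropped, the diagonal sequence
      is a subsequence of the one extracted for the n-th index.\<close>
    have "P n (diagseq \<circ> ((+) (Suc n)))"
    proof (rule diagseq_holds)
      show "P n (\<phi> \<circ> r)" if "strict_mono r" "P n \<phi>" for \<phi> r n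
        using aa_sequence_subseq[of _ "s \<circ> \<phi>" r] that unfolding P_def by (simp add: comp_assoc)
    qed
    then have "aa_sequence (d i) (\<lambda>k. (s \<circ> diagseq) (k + Suc n))"
      by (simp add: P_def n comp_def add.commute)
    then show "aa_sequence (d i) (s \<circ> diagseq)" by (rule aa_sequence_shift)
  qed
qed

section \<open>Boundedness, uniform continuity and finite colourings\<close>

lemma (in line_pseudometric) line_aa_bounded:
  assumes "line_aa d"
  shows "\<exists>B. \<forall>t. d t 0 \<le> B"
proof (rule ccontr)
  assume "\<not> ?thesis"
  then have "\<forall>n::nat. \<exists>t. real n < d t 0" by (meson not_le)
  \<comment> \<open>A sequence along which the distance from 0 outgrows the index has no subsequence
    that is Cauchy in \<open>d\<close>.\<close>
  then obtain s where s: "\<And>n::nat. real n < d (s n) 0" by metis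
  obtain \<phi> :: "nat \<Rightarrow> nat" where \<phi>: "strict_mono \<phi>" "aa_sequence d (s \<circ> \<phi>)"
    using assms unfolding line_aa_def by blast
  then obtain K where "\<forall>j\<ge>K. \<forall>k\<ge>K. d (0 + (s \<circ> \<phi>) j) (0 + (s \<circ> \<phi>) k) < 1"
    unfolding aa_sequence_def by (meson zero_less_one)
  then have K: "d (s (\<phi> j)) (s (\<phi> K)) < 1" if "K \<le> j" for j using that by auto
  obtain n :: nat where n: "1 + d (s (\<phi> K)) 0 < real n" using reals_Archimedean2 by blast
  define j where "j = max K n"
  have "real n \<le> real (\<phi> j)" using seq_suble[OF \<phi>(1), of j] by (simp add: j_def)
  also have "\<dots> < d (s (\<phi> j)) 0" by (rule s)
  also have "\<dots> \<le> d (s (\<phi> j)) (s (\<phi> K)) + d (s (\<phi> K)) 0" by (rule triangle)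
  also have "\<dots> < 1 + d (s (\<phi> K)) 0" using K[of j] by (simp add: j_def)
  finally show False using n by simp
qed

text \<open>An almost period carries any point into \<open>{0..l}\<close>, where compactness makes
  continuity uniform; going there and coming back cost \<open>e / 4\<close> each.\<close>

lemma (in line_pseudometric) line_ap_uniformly_continuous:
  assumes ap: "line_ap d" and e: "0 < e"
  shows "\<exists>h>0. \<forall>s t. \<bar>s - t\<bar> < h \<longrightarrow> d s t < e"
proof -
  have "0 < e / 4" using e by simp
  then have "relatively_dense {\<tau>. \<forall>t. d (t + \<tau>) t \<le> e / 4}"
    using ap unfolding line_ap_def by blast
  then obtain l where l: "0 < l" "\<And>a. \<exists>\<tau>. a \<le> \<tau> \<and> \<tau> \<le> a + l \<and> (\<forall>t. d (t + \<tau>) t \<le> e / 4)"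
    unfolding relatively_dense_def by (auto simp: set_eq_iff) metis
  have "0 < e / 8" using e by simp
  then have "\<forall>t. \<exists>h>0. \<forall>s. \<bar>s - t\<bar> < h \<longrightarrow> d s t < e / 8"
    using ap unfolding line_ap_def line_continuous_def by blast
  then obtain h where h: "\<And>t. 0 < h t" "\<And>s t. \<bar>s - t\<bar> < h t \<Longrightarrow> d s t < e / 8" by metis
  \<comment> \<open>A Lebesgue number of a cover of \<open>{0..l}\<close> by balls of the whole
    line: \<open>t + \<tau>\<close> will lie in \<open>{0..l}\<close>, but \<open>s + \<tau>\<close>
    may fall slightly outside.\<close>
  have "\<exists>\<delta>>0. \<forall>t\<in>{0..l}. \<exists>B\<in>(\<lambda>t. ball t (h t)) ` UNIV. ball t \<delta> \<subseteq> B"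
  proof (rule Heine_Borel_lemma)
    show "{0..l} \<subseteq> \<Union> ((\<lambda>t. ball t (h t)) ` UNIV)" using h(1) centre_in_ball by blast
  qed auto
  then obtain \<delta> where \<delta>: "0 < \<delta>" "\<And>t. t \<in> {0..l} \<Longrightarrow> \<exists>c. ball t \<delta> \<subseteq> ball c (h c)" by auto
  have "d s t < e" if st: "\<bar>s - t\<bar> < \<delta>" for s t
  proof -
    obtain \<tau> where \<tau>: "- t \<le> \<tau>" "\<tau> \<le> - t + l" "\<And>t. d (t + \<tau>) t \<le> e / 4" using l(2)[of "- t"] by blast
    have "t + \<tau> \<in> {0..l}" using \<tau> by simp
    then obtain c where c: "ball (t + \<tau>) \<delta> \<subseteq> ball c (h c)" using \<delta>(2) by blast
    have "s + \<tau> \<in> ball (t + \<tau>) \<delta>" "t + \<tau> \<in> ball (t + \<tau>) \<delta>"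
      using st \<delta>(1) by (auto simp: dist_real_def)
    then have "s + \<tau> \<in> ball c (h c)" "t + \<tau> \<in> ball c (h c)" using c by blast+
    then have "d (s + \<tau>) c < e / 8" "d (t + \<tau>) c < e / 8"
      using h(2)[of "s + \<tau>" c] h(2)[of "t + \<tau>" c] by (auto simp: dist_real_def abs_minus_commute)
    moreover have "d s t \<le> d s (s + \<tau>) + (d (s + \<tau>) c + (d c (t + \<tau>) + d (t + \<tau>) t))"
      using triangle[of s t "s + \<tau>"] triangle[of "s + \<tau>" t c] triangle[of c t "t + \<tau>"] by linarith
    ultimately show ?thesis
      using \<tau>(3)[of s] \<tau>(3)[of t] commute[of s "s + \<tau>"] commute[of c "t + \<tau>"] e by linarith
  qed
  then show ?thesis using \<delta>(1) by blast
qed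

text \<open>Bochner's criterion: almost periodicity means that the translates are totally bounded in the
  uniform distance.  It is phrased as a finite colouring of the line, since colourings of finitely
  many functions can be combined.\<close>

lemma (in line_pseudometric) line_ap_colouring:
  assumes ap: "line_ap d" and e: "0 < e"
  shows "\<exists>\<kappa>::real \<Rightarrow> nat. finite (range \<kappa>) \<and> (\<forall>a b. \<kappa> a = \<kappa> b \<longrightarrow> (\<forall>t. d (t + a) (t + b) < e))"
proof -
  have "0 < e / 4" using e by simp
  then have "relatively_dense {\<tau>. \<forall>t. d (t + \<tau>) t \<le> e / 4}"
    using ap unfolding line_ap_def by blast
  then obtain l where l: "0 < l" "\<And>a. \<exists>\<tau>. a \<le> \<tau> \<and> \<tau> \<le> a + l \<and> (\<forall>t. d (t + \<tau>) t \<le> e / 4)"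
    unfolding relatively_dense_def by (auto simp: set_eq_iff) metis
  obtain h where h: "0 < h" "\<And>s t. \<bar>s - t\<bar> < h \<Longrightarrow> d s t < e / 4"
    using line_ap_uniformly_continuous[OF ap, of "e / 4"] e by auto
  \<comment> \<open>An almost period \<open>\<tau>\<close> between \<open>a - l\<close> and
    \<open>a\<close> reduces the shift by \<open>a\<close> to the shift by
    \<open>a - \<tau>\<close>, which lies in \<open>{0..l}\<close>.\<close>
  have "\<exists>\<sigma>. 0 \<le> \<sigma> \<and> \<sigma> \<le> l \<and> (\<forall>t. d (t + a) (t + \<sigma>) \<le> e / 4)" for a
  proof -
    obtain \<tau> where \<tau>: "a - l \<le> \<tau>" "\<tau> \<le> a" "\<And>t. d (t + \<tau>) t \<le> e / 4"
      using l(2)[of "a - l"] by auto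
    show ?thesis
      using \<tau>(1,2) \<tau>(3)[of "_ + (a - \<tau>)"] by (intro exI[of _ "a - \<tau>"]) (auto simp: algebra_simps)
  qed
  then obtain \<sigma> where \<sigma>: "\<And>a. 0 \<le> \<sigma> a" "\<And>a. \<sigma> a \<le> l" "\<And>a t. d (t + a) (t + \<sigma> a) \<le> e / 4"
    by metis
  \<comment> \<open>The colour is the index of the cell of length \<open>h\<close> that contains
    \<open>\<sigma> a\<close>. Equal colours put the reduced shifts within \<open>h\<close> of each
    other, so uniform continuity applies.\<close>
  define \<kappa> where "\<kappa> a = nat \<lfloor>\<sigma> a / h\<rfloor>" for a
  have "range \<kappa> \<subseteq> {..nat \<lfloor>l / h\<rfloor>}"
    using \<sigma>(2) h(1) by (auto simp: \<kappa>_def intro!: nat_mono floor_mono divide_right_mono)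
  then have "finite (range \<kappa>)" by (rule finite_subset) simp
  moreover have "d (t + a) (t + b) < e" if "\<kappa> a = \<kappa> b" for a b t
  proof -
    have "\<lfloor>\<sigma> a / h\<rfloor> = \<lfloor>\<sigma> b / h\<rfloor>"
      using that \<sigma>(1)[of a] \<sigma>(1)[of b] h(1) by (simp add: \<kappa>_def eq_nat_nat_iff)
    then have "\<bar>\<sigma> a / h - \<sigma> b / h\<bar> < 1" by linarith
    then have "\<bar>(\<sigma> a - \<sigma> b) / h\<bar> < 1" by (simp add: diff_divide_distrib)
    then have "\<bar>\<sigma> a - \<sigma> b\<bar> < h" using h(1) by simp
    then have "d (t + \<sigma> a) (t + \<sigma> b) < e / 4" by (intro h(2)) simp
    moreover have "d (t + a) (t + b) \<le> d (t + a) (t + \<sigma> a) + (d (t + \<sigma> a) (t + \<sigma> b) + d (t + \<sigma> b) (t + b))"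
      using triangle[of "t + a" "t + b" "t + \<sigma> a"] triangle[of "t + \<sigma> a" "t + b" "t + \<sigma> b"] by linarith
    ultimately show ?thesis
      using \<sigma>(3)[of t a] \<sigma>(3)[of t b] commute[of "t + \<sigma> b" "t + b"] e by linarith
  qed
  ultimately show ?thesis by blast
qed

text \<open>Subtracting from a point the chosen representative of its colour gives an element of
  \<open>S\<close>, and the finitely many representatives lie in a bounded interval. The summand 1
  in \<open>R\<close> makes the length \<open>2 * R\<close> positive.\<close>

lemma relatively_dense_if_colouring:
  fixes \<kappa> :: "real \<Rightarrow> 'c"
  assumes fin: "finite (range \<kappa>)" and S: "\<And>a b. \<kappa> a = \<kappa> b \<Longrightarrow> a - b \<in> S"
  shows "relatively_dense S"
proof -
  define \<rho> where "\<rho> c = inv_into UNIV \<kappa> c" for c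
  have \<rho>: "\<kappa> (\<rho> (\<kappa> a)) = \<kappa> a" for a by (simp add: \<rho>_def f_inv_into_f)
  define R where "R = 1 + Max ((\<lambda>c. \<bar>\<rho> c\<bar>) ` range \<kappa>)"
  have R: "\<bar>\<rho> (\<kappa> a)\<bar> \<le> R - 1" for a
    using Max_ge[of "(\<lambda>c. \<bar>\<rho> c\<bar>) ` range \<kappa>" "\<bar>\<rho> (\<kappa> a)\<bar>"] fin by (auto simp: R_def)
  show ?thesis
    unfolding relatively_dense_def
  proof (intro exI[of _ "2 * R"] conjI allI)
    fix a
    have "a + R - \<rho> (\<kappa> (a + R)) \<in> S" by (rule S) (simp add: \<rho>)
    moreover have "a + R - \<rho> (\<kappa> (a + R)) \<in> {a..a + 2 * R}" using R[of "a + R"] by auto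
    ultimately show "{a..a + 2 * R} \<inter> S \<noteq> {}" by blast
  qed (use R[of 0] in linarith)
qed

text \<open>Up to distance 1 only finitely many positions occur, one for each colour. Such a bound
  is what gives the supremum in \<open>Sp_norm\<close> its meaning.\<close>

lemma (in line_pseudometric) line_ap_bounded:
  assumes "line_ap d"
  shows "\<exists>B. \<forall>t. d t 0 \<le> B"
proof -
  obtain \<kappa> :: "real \<Rightarrow> nat" where \<kappa>: "finite (range \<kappa>)"
    "\<And>a b t. \<kappa> a = \<kappa> b \<Longrightarrow> d (t + a) (t + b) < 1"
    using line_ap_colouring[OF assms, of 1] by auto
  define \<rho> where "\<rho> c = inv_into UNIV \<kappa> c" for c
  have \<rho>: "\<kappa> (\<rho> (\<kappa> a)) = \<kappa> a" for a by (simp add: \<rho>_def f_inv_into_f)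
  have "d t 0 \<le> 1 + Max ((\<lambda>c. d (\<rho> c) 0) ` range \<kappa>)" for t
  proof -
    have "d t 0 \<le> d t (\<rho> (\<kappa> t)) + d (\<rho> (\<kappa> t)) 0" by (rule triangle)
    moreover have "d t (\<rho> (\<kappa> t)) < 1" using \<kappa>(2)[of t "\<rho> (\<kappa> t)" 0] \<rho> by simp
    moreover have "d (\<rho> (\<kappa> t)) 0 \<le> Max ((\<lambda>c. d (\<rho> c) 0) ` range \<kappa>)"
      using \<kappa>(1) by (intro Max_ge) auto
    ultimately show ?thesis by linarith
  qed
  then show ?thesis by blast
qed

text \<open>In the application \<open>dU\<close>, \<open>dF x\<close> and \<open>dW\<close> come from \<open>u\<close>, from \<open>f (\<cdot>, x)\<close> and from \<open>f (\<cdot>, u)\<close>.  The finite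
  set in \<open>controlled\<close> depends on the base point \<open>c\<close>, because only pieces of the range of \<open>u\<close> can be
  approximated by finitely many values.\<close>

locale controlled_line =
  dU: line_pseudometric dU + dW: line_pseudometric dW
  for dU :: "real \<Rightarrow> real \<Rightarrow> real" and dF :: "'x \<Rightarrow> real \<Rightarrow> real \<Rightarrow> real"
    and dW :: "real \<Rightarrow> real \<Rightarrow> real" +
  assumes dF: "line_pseudometric (dF x)"
    and controlled: "0 < e \<Longrightarrow> \<exists>\<eta>>0. \<forall>c. \<exists>D \<delta>. finite D \<and> 0 < \<delta> \<and>
    (\<forall>a b. dU a c < \<eta> \<longrightarrow> dU b c < \<eta> \<longrightarrow> (\<forall>x\<in>D. dF x a b < \<delta>) \<longrightarrow> dW a b < e)"
begin

section \<open>Transfer of continuity, almost automorphy and almost periodicity\<close>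

lemma line_continuous_W:
  assumes U: "line_continuous dU" and F: "\<And>x. line_continuous (dF x)"
  shows "line_continuous dW"
  unfolding line_continuous_def
proof (intro allI impI)
  fix t e :: real assume "0 < e"
  then obtain \<eta> D' \<delta>' where \<eta>: "0 < \<eta>"
    and D': "\<And>c::real. finite (D' c)" "\<And>c. (0::real) < \<delta>' c"
    and W': "\<And>c a b. dU a c < \<eta> \<Longrightarrow> dU b c < \<eta> \<Longrightarrow>
      (\<And>x. x \<in> D' c \<Longrightarrow> dF x a b < \<delta>' c) \<Longrightarrow> dW a b < e"
    using controlled[of e] by metis
  \<comment> \<open>The base point is \<open>t\<close> itself, so the condition on the second point
    reads \<open>dU t t = 0 < \<eta>\<close>.\<close>
  define D where "D = D' t"
  define \<delta> where "\<delta> = \<delta>' t"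
  have D: "finite D" "0 < \<delta>" using D' by (simp_all add: D_def \<delta>_def)
  have W: "dW a b < e"
    if "dU a t < \<eta>" "dU b t < \<eta>" "\<And>x. x \<in> D \<Longrightarrow> dF x a b < \<delta>" for a b
    using W'[of a t b] that by (simp add: D_def \<delta>_def)
  obtain h where h: "0 < h" "\<And>s. \<bar>s - t\<bar> < h \<Longrightarrow> dU s t < \<eta>"
    using line_continuousD[OF U \<eta>] by metis
  obtain g where g: "\<And>x. 0 < g x" "\<And>x s. \<bar>s - t\<bar> < g x \<Longrightarrow> dF x s t < \<delta>"
    using line_continuousD[OF F D(2)] by metis
  define m where "m = Min (insert h (g ` D))"
  have m: "0 < m" "m \<le> h" "\<And>x. x \<in> D \<Longrightarrow> m \<le> g x"
    using D(1) h(1) g(1) by (auto simp: m_def)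
  have "dW s t < e" if "\<bar>s - t\<bar> < m" for s
    using that m(2) m(3) \<eta> by (intro W h(2) g(2)) (auto simp: dU.refl0 intro: less_le_trans)
  then show "\<exists>h>0. \<forall>s. \<bar>s - t\<bar> < h \<longrightarrow> dW s t < e" using m(1) by blast
qed

lemma line_aa_W:
  assumes U: "line_aa dU" and F: "\<And>x. line_aa (dF x)"
  shows "line_aa dW"
  unfolding line_aa_def
proof (intro conjI allI)
  show "line_continuous dW" using U F by (auto simp: line_aa_def intro: line_continuous_W)
  fix s :: "nat \<Rightarrow> real"
  have "\<forall>n::nat. \<exists>\<eta>>0. \<forall>c. \<exists>D \<delta>. finite D \<and> 0 < \<delta> \<and> (\<forall>a b. dU a c < \<eta> \<longrightarrow> dU b c < \<eta> \<longrightarrow>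
      (\<forall>x\<in>D. dF x a b < \<delta>) \<longrightarrow> dW a b < 1 / Suc n)"
    by (intro allI controlled) simp
  then obtain \<eta> D \<delta> where \<eta>: "\<And>n::nat. 0 < \<eta> n"
    and D: "\<And>n (c::real). finite (D n c)" "\<And>n c. (0::real) < \<delta> n c"
    and W: "\<And>n c a b. dU a c < \<eta> n \<Longrightarrow> dU b c < \<eta> n \<Longrightarrow>
      (\<And>x. x \<in> D n c \<Longrightarrow> dF x a b < \<delta> n c) \<Longrightarrow> dW a b < 1 / Suc n"
    by metis
  \<comment> \<open>\<open>None\<close> stands for \<open>u\<close> itself, \<open>Some x\<close>
    for \<open>f (\<cdot>, x)\<close>. Rational base points and tolerances \<open>1 / Suc n\<close>
    keep the family countable.\<close>
  define I where "I = insert None (\<Union>n. \<Union>c\<in>\<rat>. Some ` D n c)"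
  define d where "d i = (case i of None \<Rightarrow> dU | Some x \<Rightarrow> dF x)" for i
  have "countable I"
    unfolding I_def using D(1) by (intro countable_insert countable_UN countable_rat countable_image) (auto intro: countable_finite)
  moreover have "line_aa (d i)" for i
    using U F by (auto simp: d_def split: option.split)
  ultimately obtain \<phi> :: "nat \<Rightarrow> nat"
    where \<phi>: "strict_mono \<phi>" "\<And>i. i \<in> I \<Longrightarrow> aa_sequence (d i) (s \<circ> \<phi>)"
    using common_aa_subsequence by metis
  define r where "r = s \<circ> \<phi>"
  have rU: "aa_sequence dU r" using \<phi>(2)[of None] by (simp add: I_def d_def r_def)
  have rF: "aa_sequence (dF x) r" if "c \<in> \<rat>" "x \<in> D n c" for n c x
    using \<phi>(2)[of "Some x"] that by (auto simp: I_def d_def r_def)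
  have near: "\<exists>c\<in>\<rat>. dU t c < h" if h: "0 < h" for t h
  proof -
    obtain g where g: "0 < g" "\<And>s. \<bar>s - t\<bar> < g \<Longrightarrow> dU s t < h"
      using U line_continuousD[OF _ h, of dU t] unfolding line_aa_def by blast
    obtain c where "c \<in> \<rat>" "t < c" "c < t + g" using Rats_dense_in_real[of t "t + g"] g(1) by auto
    then show ?thesis using g(2)[of c] dU.commute[of t c] by (intro bexI[of _ c]) auto
  qed
  have "aa_sequence dW r"
    unfolding aa_sequence_def
  proof (intro conjI allI impI)
    fix t e :: real assume "0 < e"
    then obtain n where n: "1 / real (Suc n) < e" using nat_approx_posE by blast
    have half: "0 < \<eta> n / 2" using \<eta>[of n] by simp
    obtain K0 where K0: "\<And>j k. K0 \<le> j \<Longrightarrow> K0 \<le> k \<Longrightarrow> dU (t + r j) (t + r k) < \<eta> n / 2"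
      using rU half unfolding aa_sequence_def by meson
    \<comment> \<open>From index \<open>K0\<close> on all positions stay within
      \<open>\<eta> n / 2\<close> of the one at \<open>t + r K0\<close>, so one rational base point
      near it serves the whole tail.\<close>
    obtain c where c: "c \<in> \<rat>" "dU (t + r K0) c < \<eta> n / 2" using near[OF half] by blast
    have "\<exists>K. \<forall>j\<ge>K. \<forall>k\<ge>K. dF x (t + r j) (t + r k) < \<delta> n c" if "x \<in> D n c" for x
      using rF[OF c(1) that] D(2)[of n c] unfolding aa_sequence_def by blast
    then obtain K where K: "\<And>x j k. x \<in> D n c \<Longrightarrow> K x \<le> j \<Longrightarrow> K x \<le> k \<Longrightarrow>
        dF x (t + r j) (t + r k) < \<delta> n c"
      by metis
    define K' where "K' = Max (insert K0 (K ` D n c))"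
    have K': "K0 \<le> K'" "\<And>x. x \<in> D n c \<Longrightarrow> K x \<le> K'" using D(1)[of n c] by (auto simp: K'_def)
    have Uc: "dU (t + r j) c < \<eta> n" if "K' \<le> j" for j
      using K0[of j K0] c(2) dU.triangle[of "t + r j" c "t + r K0"] that K'(1) by fastforce
    have "dW (t + r j) (t + r k) < e" if "K' \<le> j" "K' \<le> k" for j k
    proof -
      have "dW (t + r j) (t + r k) < 1 / Suc n"
        using that K'(2) by (intro W[of _ c] Uc K) (auto intro: le_trans)
      then show ?thesis using n by simp
    qed
    then show "\<exists>K. \<forall>j\<ge>K. \<forall>k\<ge>K. dW (t + r j) (t + r k) < e" by blast
  next
    fix t e :: real assume "0 < e"
    then obtain n where n: "1 / real (Suc n) < e" using nat_approx_posE by blast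
    have half: "0 < \<eta> n / 2" using \<eta>[of n] by simp
    \<comment> \<open>Here the positions return to that of \<open>t\<close>, so the base point is
      taken near \<open>t\<close>, and \<open>t\<close> itself is the second point in
      \<open>W\<close>.\<close>
    obtain c where c: "c \<in> \<rat>" "dU t c < \<eta> n / 2" using near[OF half] by blast
    obtain K0 where K0: "\<And>k. K0 \<le> k \<Longrightarrow> \<exists>J. \<forall>j\<ge>J. dU (t - r k + r j) t < \<eta> n / 2"
      using rU half unfolding aa_sequence_def by meson
    have "\<exists>K. \<forall>k\<ge>K. \<exists>J. \<forall>j\<ge>J. dF x (t - r k + r j) t < \<delta> n c" if "x \<in> D n c" for x
      using rF[OF c(1) that] D(2)[of n c] unfolding aa_sequence_def by blast
    then obtain K where K: "\<And>x k. x \<in> D n c \<Longrightarrow> K x \<le> k \<Longrightarrow>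
        \<exists>J. \<forall>j\<ge>J. dF x (t - r k + r j) t < \<delta> n c"
      by metis
    define K' where "K' = Max (insert K0 (K ` D n c))"
    have K': "K0 \<le> K'" "\<And>x. x \<in> D n c \<Longrightarrow> K x \<le> K'" using D(1)[of n c] by (auto simp: K'_def)
    have "\<exists>J. \<forall>j\<ge>J. dW (t - r k + r j) t < e" if k: "K' \<le> k" for k
    proof -
      obtain J0 where J0: "\<And>j. J0 \<le> j \<Longrightarrow> dU (t - r k + r j) t < \<eta> n / 2"
        using K0[of k] k K'(1) by (meson le_trans)
      \<comment> \<open>The inner limit is taken for fixed \<open>k\<close>, so the threshold
        depends on \<open>k\<close> as well as on \<open>x\<close>; finiteness of
        \<open>D n c\<close> again allows a maximum.\<close>
      obtain J where J: "\<And>x j. x \<in> D n c \<Longrightarrow> J x \<le> j \<Longrightarrow> dF x (t - r k + r j) t < \<delta> n c"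
        using K[OF _ le_trans[OF K'(2) k]] by metis
      define J' where "J' = Max (insert J0 (J ` D n c))"
      have J': "J0 \<le> J'" "\<And>x. x \<in> D n c \<Longrightarrow> J x \<le> J'" using D(1)[of n c] by (auto simp: J'_def)
      have "dW (t - r k + r j) t < e" if j: "J' \<le> j" for j
      proof -
        have "dU (t - r k + r j) c < \<eta> n"
          using J0[of j] c(2) dU.triangle[of "t - r k + r j" c t] j J'(1) by fastforce
        moreover have "dU t c < \<eta> n" using c(2) half by linarith
        ultimately have "dW (t - r k + r j) t < 1 / Suc n"
          using J'(2) j by (intro W[of _ c] J) (auto intro: le_trans)
        then show ?thesis using n by simp
      qed
      then show ?thesis by blast
    qed
    then show "\<exists>K. \<forall>k\<ge>K. \<exists>J. \<forall>j\<ge>J. dW (t - r k + r j) t < e" by blast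
  qed
  then show "\<exists>\<phi>. strict_mono (\<phi> :: nat \<Rightarrow> nat) \<and> aa_sequence dW (s \<circ> \<phi>)"
    using \<phi>(1) r_def by blast
qed

text \<open>Relatively dense sets of almost periods may fail to meet, whereas colourings can be
  multiplied: two points of equal product colour differ by an almost period of all the functions at
  once.\<close>

lemma line_ap_W:
  assumes U: "line_ap dU" and F: "\<And>x. line_ap (dF x)"
  shows "line_ap dW"
  unfolding line_ap_def
proof (intro conjI allI impI)
  show "line_continuous dW" using U F by (auto simp: line_ap_def intro: line_continuous_W)
  fix e :: real assume "0 < e"
  then obtain \<eta> D \<delta> where \<eta>: "0 < \<eta>"
    and D: "\<And>c::real. finite (D c)" "\<And>c. (0::real) < \<delta> c"
    and W: "\<And>c a b. dU a c < \<eta> \<Longrightarrow> dU b c < \<eta> \<Longrightarrow>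
      (\<And>x. x \<in> D c \<Longrightarrow> dF x a b < \<delta> c) \<Longrightarrow> dW a b < e"
    using controlled[of e] by metis
  have half: "0 < \<eta> / 2" using \<eta> by simp
  obtain \<kappa> :: "real \<Rightarrow> nat" where \<kappa>: "finite (range \<kappa>)"
    "\<And>a b t. \<kappa> a = \<kappa> b \<Longrightarrow> dU (t + a) (t + b) < \<eta> / 2"
    using dU.line_ap_colouring[OF U half] by blast
  \<comment> \<open>One representative per colour gives a finite net: by the colouring property at
    \<open>0\<close>, every position is within \<open>\<eta> / 2\<close> of that of some
    \<open>c\<close> in \<open>C\<close>.\<close>
  define C where "C = inv_into UNIV \<kappa> ` range \<kappa>"
  have C: "finite C" using \<kappa>(1) by (simp add: C_def)
  have cover: "\<exists>c\<in>C. dU t c < \<eta> / 2" for t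
    using \<kappa>(2)[of t "inv_into UNIV \<kappa> (\<kappa> t)" 0] by (auto simp: C_def f_inv_into_f)
  define E where "E = (\<Union>c\<in>C. D c)"
  define \<delta>' where "\<delta>' = Min (insert 1 (\<delta> ` C))"
  have E: "finite E" using C D(1) by (auto simp: E_def)
  have \<delta>': "0 < \<delta>'" "\<And>c. c \<in> C \<Longrightarrow> \<delta>' \<le> \<delta> c" using C D(2) by (auto simp: \<delta>'_def)
  obtain \<mu> :: "'x \<Rightarrow> real \<Rightarrow> nat" where \<mu>: "\<And>x. finite (range (\<mu> x))"
    "\<And>x a b t. \<mu> x a = \<mu> x b \<Longrightarrow> dF x (t + a) (t + b) < \<delta>'"
    using line_pseudometric.line_ap_colouring[OF dF F \<delta>'(1)] by metis
  show "relatively_dense {\<tau>. \<forall>t. dW (t + \<tau>) t \<le> e}"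
  proof (rule relatively_dense_if_colouring)
    \<comment> \<open>Restriction to the finite set \<open>E\<close> keeps the number of product
      colours finite.\<close>
    define \<nu> where "\<nu> a = (\<kappa> a, restrict (\<lambda>x. \<mu> x a) E)" for a
    have "range \<nu> \<subseteq> range \<kappa> \<times> PiE E (\<lambda>x. range (\<mu> x))" by (auto simp: \<nu>_def)
    then show "finite (range \<nu>)"
      using \<kappa>(1) \<mu>(1) E by (elim finite_subset) (intro finite_cartesian_product finite_PiE)
    fix a b assume ab: "\<nu> a = \<nu> b"
    have \<mu>ab: "\<mu> x a = \<mu> x b" if "x \<in> E" for x
      using ab that by (auto simp: \<nu>_def restrict_def fun_eq_iff split: if_splits)
    have "dW (t + (a - b)) t < e" for t
    proof -
      obtain c where c: "c \<in> C" "dU t c < \<eta> / 2" using cover by blast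
      have "dU (t + (a - b)) t < \<eta> / 2"
        using \<kappa>(2)[of a b "t - b"] ab by (simp add: \<nu>_def algebra_simps)
      then have "dU (t + (a - b)) c < \<eta>"
        using c(2) dU.triangle[of "t + (a - b)" c t] by linarith
      moreover have "dU t c < \<eta>" using c(2) \<eta> by linarith
      moreover have "dF x (t + (a - b)) t < \<delta> c" if "x \<in> D c" for x
      proof -
        have "x \<in> E" using that c(1) by (auto simp: E_def)
        then have "dF x (t - b + a) (t - b + b) < \<delta>'" by (intro \<mu>(2) \<mu>ab)
        then show ?thesis using \<delta>'(2)[OF c(1)] by (simp add: algebra_simps)
      qed
      ultimately show ?thesis by (rule W)
    qed
    then show "a - b \<in> {\<tau>. \<forall>t. dW (t + \<tau>) t \<le> e}" by (auto intro: less_imp_le)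
  qed
qed

end

section \<open>Bochner measurability, approximation and completeness in $L^p$\<close>

lemma finite_measure_interval: "finite_measure (lebesgue_on {a<..<b::real})"
  using lmeasurable_box[of a b] by (simp add: finite_measure_lebesgue_on)

text \<open>The integrals are summable, so the series of the \<open>h n\<close> has finite integral,
  converges almost everywhere, and its terms tend to 0.\<close>

lemma AE_tendsto_0_if_nn_integral_le:
  fixes h :: "nat \<Rightarrow> 'a \<Rightarrow> real"
  assumes [measurable]: "\<And>n. h n \<in> borel_measurable M" and nonneg: "\<And>n x. 0 \<le> h n x"
    and le: "\<And>n. (\<integral>\<^sup>+x. ennreal (h n x) \<partial>M) \<le> ennreal ((1/2) ^ n)"
  shows "AE x in M. (\<lambda>n. h n x) \<longlonglongrightarrow> 0"
proof -
  have "(\<integral>\<^sup>+x. (\<Sum>n. ennreal (h n x)) \<partial>M) = (\<Sum>n. \<integral>\<^sup>+x. ennreal (h n x) \<partial>M)"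
    by (rule nn_integral_suminf) measurable
  also have "\<dots> \<le> (\<Sum>n. ennreal ((1/2) ^ n))"
    using le by (rule suminf_le) auto
  also have "\<dots> = ennreal (\<Sum>n. (1/2) ^ n)"
    by (rule suminf_ennreal2) (auto intro!: summable_geometric)
  finally have "(\<integral>\<^sup>+x. (\<Sum>n. ennreal (h n x)) \<partial>M) \<noteq> \<infinity>"
    by (auto simp: top_unique)
  then have "AE x in M. (\<Sum>n. ennreal (h n x)) \<noteq> \<infinity>"
    by (intro nn_integral_PInf_AE) measurable
  then show ?thesis
  proof eventually_elim
    case (elim x)
    then have "summable (\<lambda>n. h n x)" using nonneg by (intro summable_suminf_not_top) auto
    then show ?case by (rule summable_LIMSEQ_zero)
  qed
qed

lemma bochner_measurable_simple:
  assumes "simple_function (lebesgue_on {a<..<b}) f"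
  shows "bochner_measurable a b f"
  unfolding bochner_measurable_def using assms by (intro exI[of _ "\<lambda>_. f"]) auto

text \<open>Convergence in measure allows a diagonal choice among the simple functions that approximate
  the \<open>g n\<close>.\<close>

lemma bochner_measurable_LIMSEQ_AE:
  fixes g :: "nat \<Rightarrow> real \<Rightarrow> 'e::banach"
  assumes g: "\<And>n. bochner_measurable a b (g n)"
    and lim: "AE x in lebesgue_on {a<..<b}. (\<lambda>n. g n x) \<longlonglongrightarrow> f x"
  shows "bochner_measurable a b f"
proof -
  let ?M = "lebesgue_on {a<..<b}"
  interpret finite_measure ?M by (rule finite_measure_interval)
  have "\<forall>n. \<exists>s. (\<forall>i::nat. simple_function ?M (s i)) \<and> (AE x in ?M. (\<lambda>i. s i x) \<longlonglongrightarrow> g n x)"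
    using g unfolding bochner_measurable_def by blast
  then have "\<exists>s. \<forall>n. (\<forall>i::nat. simple_function ?M (s n i)) \<and> (AE x in ?M. (\<lambda>i. s n i x) \<longlonglongrightarrow> g n x)"
    by (rule choice)
  then obtain s where s: "\<And>n i::nat. simple_function ?M (s n i)"
    and slim: "\<And>n. AE x in ?M. (\<lambda>i. s n i x) \<longlonglongrightarrow> g n x" by blast
  \<comment> \<open>Truncation at 1 provides a dominating constant on the bounded interval although
    the \<open>g n\<close> need not be integrable; small distances are left unchanged.\<close>
  define h where "h n i x = min 1 (norm (s n i x - g n x))" for n i x
  have h[measurable]: "h n i \<in> borel_measurable ?M" for n i
  proof -
    have "(\<lambda>x. s n i x - g n x) \<in> borel_measurable ?M"
      by (intro bochner_measurable_imp_borel bochner_measurable_diff bochner_measurable_simple s g)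
    then show ?thesis unfolding h_def by measurable
  qed
  have hint: "integrable ?M (h n i)" for n i
    by (rule integrable_const_bound[of _ 1]) (auto simp: h_def)
  have "(\<lambda>i. integral\<^sup>L ?M (h n i)) \<longlonglongrightarrow> integral\<^sup>L ?M (\<lambda>_. 0)" for n
  proof (rule integral_dominated_convergence[where w = "\<lambda>_. 1"])
    show "AE x in ?M. (\<lambda>i. h n i x) \<longlonglongrightarrow> 0"
      using slim[of n]
    proof eventually_elim
      case (elim x)
      then have "(\<lambda>i. min 1 (norm (s n i x - g n x))) \<longlonglongrightarrow> min 1 (norm (g n x - g n x))"
        by (intro tendsto_intros)
      then show ?case by (simp add: h_def)
    qed
  qed (auto simp: h_def[abs_def] intro: h[unfolded h_def[abs_def]])
  then have "\<exists>i. integral\<^sup>L ?M (h n i) < (1/2) ^ n" for n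
    using order_tendstoD(2)[of "\<lambda>i. integral\<^sup>L ?M (h n i)" 0 sequentially "(1/2) ^ n"]
    by (auto simp: eventually_sequentially)
  \<comment> \<open>The summable bounds turn convergence in mean into convergence almost everywhere
    along the chosen indices.\<close>
  then obtain k where k: "\<And>n. integral\<^sup>L ?M (h n (k n)) < (1/2) ^ n" by metis
  have "AE x in ?M. (\<lambda>n. h n (k n) x) \<longlonglongrightarrow> 0"
  proof (rule AE_tendsto_0_if_nn_integral_le)
    show "(\<integral>\<^sup>+x. ennreal (h n (k n) x) \<partial>?M) \<le> ennreal ((1/2) ^ n)" for n
      using k[of n] hint[of n "k n"] by (subst nn_integral_eq_integral) (auto simp: h_def less_imp_le intro: ennreal_leI)
  qed (auto simp: h_def[abs_def] intro: h[unfolded h_def[abs_def]])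
  then have "AE x in ?M. (\<lambda>n. s n (k n) x) \<longlonglongrightarrow> f x"
    using lim
  proof eventually_elim
    case (elim x)
    have "eventually (\<lambda>n. h n (k n) x < 1) sequentially"
      using order_tendstoD(2)[OF elim(1)] by simp
    then have "eventually (\<lambda>n. h n (k n) x = norm (s n (k n) x - g n x)) sequentially"
      by eventually_elim (auto simp: h_def)
    then have "(\<lambda>n. norm (s n (k n) x - g n x)) \<longlonglongrightarrow> 0"
      by (rule Lim_transform_eventually[OF elim(1)])
    then have "(\<lambda>n. s n (k n) x - g n x) \<longlonglongrightarrow> 0" by (rule tendsto_norm_zero_cancel)
    from tendsto_add[OF this elim(2)] show ?case by simp
  qed
  then show ?thesis
    unfolding bochner_measurable_def using s by (intro exI[of _ "\<lambda>n. s n (k n)"]) auto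
qed

lemma Lp_fun_simple:
  fixes f :: "real \<Rightarrow> 'e::banach"
  assumes f: "simple_function (lebesgue_on {a<..<b}) f"
  shows "f \<in> Lp_fun p a b"
proof -
  let ?M = "lebesgue_on {a<..<b}"
  interpret finite_measure ?M by (rule finite_measure_interval)
  have fin: "finite ((\<lambda>x. norm (f x) powr p) ` {a<..<b})"
    using simple_functionD(1)[OF simple_function_compose1[OF f, of "\<lambda>y. norm y powr p"]] by simp
  have [measurable]: "f \<in> borel_measurable ?M" by (rule borel_measurable_simple_function[OF f])
  have "integrable ?M (\<lambda>x. norm (f x) powr p)"
    by (rule integrable_const_bound[of _ "Max ((\<lambda>x. norm (f x) powr p) ` {a<..<b})"])
      (use fin in auto)
  then show ?thesis using bochner_measurable_simple[OF f] by (simp add: Lp_fun_def)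
qed

lemma Lp_norm_nonneg: "0 \<le> Lp_norm p a b f"
  by (simp add: Lp_norm_def)

lemma Lp_norm_less_iff:
  assumes "1 \<le> p" "0 < e"
  shows "Lp_norm p a b f < e \<longleftrightarrow> (\<integral>x. norm (f x) powr p \<partial>lebesgue_on {a<..<b}) < e powr p"
proof -
  have "Lp_norm p a b f powr p = (\<integral>x. norm (f x) powr p \<partial>lebesgue_on {a<..<b})"
    using assms by (simp add: Lp_norm_def powr_powr)
  then show ?thesis
    using powr_less_mono2[of p "Lp_norm p a b f" e] powr_mono2[of p e "Lp_norm p a b f"] assms
    by (smt (verit) Lp_norm_nonneg)
qed

lemma Lp_norm_le_iff:
  assumes "1 \<le> p" "0 \<le> e"
  shows "Lp_norm p a b f \<le> e \<longleftrightarrow> (\<integral>x. norm (f x) powr p \<partial>lebesgue_on {a<..<b}) \<le> e powr p"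
proof -
  have "Lp_norm p a b f powr p = (\<integral>x. norm (f x) powr p \<partial>lebesgue_on {a<..<b})"
    using assms by (simp add: Lp_norm_def powr_powr)
  then show ?thesis
    using powr_less_mono2[of p e "Lp_norm p a b f"] powr_mono2[of p "Lp_norm p a b f" e] assms
    by (smt (verit) Lp_norm_nonneg)
qed

lemma tendsto_norm_powr_zero:
  fixes f :: "'a \<Rightarrow> 'e::real_normed_vector"
  assumes "(f \<longlongrightarrow> 0) F" "1 \<le> (p::real)"
  shows "((\<lambda>x. norm (f x) powr p) \<longlongrightarrow> 0) F"
proof -
  have "((\<lambda>x. norm (f x) powr p) \<longlongrightarrow> 0 powr p) F"
    using assms by (intro tendsto_powr') (auto intro: tendsto_norm_zero)
  then show ?thesis using assms by simp
qed

section \<open>Simple approximation, Hoelder's inequality and completeness\<close>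

lemma Lp_simple_approx:
  fixes u :: "real \<Rightarrow> 'e::banach"
  assumes p: "1 \<le> p" and u: "u \<in> Lp_fun p a b" and e: "0 < e"
  obtains \<phi> where "simple_function (lebesgue_on {a<..<b}) \<phi>" "Lp_norm p a b (\<lambda>x. u x - \<phi> x) < e"
proof -
  let ?M = "lebesgue_on {a<..<b}"
  have ubm: "bochner_measurable a b u" and uint: "integrable ?M (\<lambda>x. norm (u x) powr p)"
    using u by (auto simp: Lp_fun_def)
  have um[measurable]: "u \<in> borel_measurable ?M" by (rule bochner_measurable_imp_borel[OF ubm])
  obtain s where s: "\<And>i::nat. simple_function ?M (s i)"
    and lim: "AE x in ?M. (\<lambda>i. s i x) \<longlonglongrightarrow> u x"
    using ubm unfolding bochner_measurable_def by blast
  have [measurable]: "s i \<in> borel_measurable ?M" for i by (rule borel_measurable_simple_function[OF s])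
  \<comment> \<open>Discarding values larger than \<open>2 * norm (u x)\<close> yields the
    integrable bound \<open>3 * norm (u x)\<close> for the error. The limit survives: where
    \<open>u x\<close> is nonzero the test eventually succeeds, and where it is 0 so is
    \<open>\<phi> i x\<close>.\<close>
  define \<phi> where "\<phi> i x = (if norm (s i x) \<le> 2 * norm (u x) then s i x else 0)" for i x
  have \<phi>: "simple_function ?M (\<phi> i)" for i
    unfolding \<phi>_def by (intro simple_function_If s simple_function_const) measurable
  have \<phi>lim: "AE x in ?M. (\<lambda>i. \<phi> i x) \<longlonglongrightarrow> u x"
    using lim
  proof eventually_elim
    case (elim x)
    show ?case
    proof (cases "u x = 0")
      case True
      then have "\<phi> i x = 0" for i by (simp add: \<phi>_def)
      then show ?thesis using True by simp
    next
      case False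
      then have "eventually (\<lambda>i. norm (s i x) < 2 * norm (u x)) sequentially"
        using order_tendstoD(2)[OF tendsto_norm[OF elim]] by simp
      then have "eventually (\<lambda>i. \<phi> i x = s i x) sequentially"
        by eventually_elim (simp add: \<phi>_def)
      then have "eventually (\<lambda>i. s i x = \<phi> i x) sequentially" by eventually_elim simp
      then show ?thesis by (rule Lim_transform_eventually[OF elim])
    qed
  qed
  have diff[measurable]: "(\<lambda>x. u x - \<phi> i x) \<in> borel_measurable ?M" for i
    by (intro bochner_measurable_imp_borel bochner_measurable_diff bochner_measurable_simple \<phi> ubm)
  have "(\<lambda>i. \<integral>x. norm (u x - \<phi> i x) powr p \<partial>?M) \<longlonglongrightarrow> (\<integral>x. 0 \<partial>?M)"
  proof (rule integral_dominated_convergence[where w = "\<lambda>x. 3 powr p * norm (u x) powr p"])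
    show "integrable ?M (\<lambda>x. 3 powr p * norm (u x) powr p)" using uint by simp
    show "AE x in ?M. (\<lambda>i. norm (u x - \<phi> i x) powr p) \<longlonglongrightarrow> 0"
      using \<phi>lim
    proof eventually_elim
      case (elim x)
      have "(\<lambda>i. u x - \<phi> i x) \<longlonglongrightarrow> u x - u x" by (intro tendsto_intros elim)
      then show ?case using p by (intro tendsto_norm_powr_zero) auto
    qed
    show "AE x in ?M. norm (norm (u x - \<phi> i x) powr p) \<le> 3 powr p * norm (u x) powr p" for i
    proof (rule AE_I2)
      fix x
      have "norm (u x - \<phi> i x) \<le> 3 * norm (u x)"
        using norm_triangle_ineq4[of "u x" "\<phi> i x"] by (auto simp: \<phi>_def split: if_splits)
      then have "norm (u x - \<phi> i x) powr p \<le> (3 * norm (u x)) powr p"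
        using p by (intro powr_mono2) auto
      then show "norm (norm (u x - \<phi> i x) powr p) \<le> 3 powr p * norm (u x) powr p"
        by (simp add: powr_mult)
    qed
  qed measurable
  then have "eventually (\<lambda>i. (\<integral>x. norm (u x - \<phi> i x) powr p \<partial>?M) < e powr p) sequentially"
    using e by (intro order_tendstoD(2)) auto
  then obtain i where "(\<integral>x. norm (u x - \<phi> i x) powr p \<partial>?M) < e powr p"
    by (auto simp: eventually_sequentially)
  then show thesis using that[OF \<phi>[of i]] Lp_norm_less_iff[OF p e] by blast
qed

text \<open>Young's inequality for \<open>a powr q\<close> and \<open>b powr q\<close> with the
  conjugate exponents \<open>r / q\<close> and \<open>p / q\<close>.\<close>

lemma Young_powr:
  fixes a b p q r :: real
  assumes "1 \<le> p" "1 \<le> q" "1 \<le> r" "1 / q = 1 / p + 1 / r" "0 \<le> a" "0 \<le> b"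
  shows "(a * b) powr q \<le> q / r * a powr r + q / p * b powr p"
proof -
  have lt: "1 / r < 1 / q" "1 / p < 1 / q" using assms by auto
  then have gt: "1 < r / q" "1 < p / q" using assms(1-3) by (simp_all add: field_simps)
  have "1 / (r / q) + 1 / (p / q) = q * (1 / p + 1 / r)" by (simp add: distrib_left add.commute)
  also have "\<dots> = 1" using assms(2) by (simp flip: assms(4))
  finally have "a powr q * b powr q \<le> (a powr q) powr (r / q) / (r / q) + (b powr q) powr (p / q) / (p / q)"
    using gt assms by (intro Youngs_inequality) auto
  then show ?thesis using assms by (simp add: powr_powr powr_mult mult.commute)
qed

text \<open>After division by positive bounds \<open>A\<close> and \<open>B\<close> of the two
  norms, the right side of Young's inequality integrates to at most
  \<open>q / r + q / p = 1\<close>. Since a norm may vanish, larger bounds are used first and then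
  decreased to the norms.\<close>

lemma Holder_Lp:
  fixes h :: "real \<Rightarrow> 'y::banach" and v :: "real \<Rightarrow> 'x::banach" and l :: "real \<Rightarrow> real"
  assumes exps: "1 \<le> p" "1 \<le> q" "1 \<le> r" "1 / q = 1 / p + 1 / r"
    and l: "l \<in> Lp_fun r a b" and v: "v \<in> Lp_fun p a b" and h: "bochner_measurable a b h"
    and le: "AE x in lebesgue_on {a<..<b}. norm (h x) \<le> l x * norm (v x)"
  shows "h \<in> Lp_fun q a b" "Lp_norm q a b h \<le> Lp_norm r a b l * Lp_norm p a b v"
proof -
  let ?M = "lebesgue_on {a<..<b}"
  have hm[measurable]: "h \<in> borel_measurable ?M" by (rule bochner_measurable_imp_borel[OF h])
  have int: "integrable ?M (\<lambda>x. norm (l x) powr r)" "integrable ?M (\<lambda>x. norm (v x) powr p)"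
    using l v by (auto simp: Lp_fun_def)
  have pw: "AE x in ?M. norm (h x) powr q \<le> (A * B) powr q *
      (q / r * (norm (l x) powr r / A powr r) + q / p * (norm (v x) powr p / B powr p))"
    if "0 < A" "0 < B" for A B
    using le
  proof eventually_elim
    case (elim x)
    have "l x * norm (v x) \<le> norm (l x) * norm (v x)"
      by (intro mult_right_mono) auto
    with elim have "norm (h x) \<le> (A * B) * (norm (l x) / A * (norm (v x) / B))"
      using that by simp
    then have "norm (h x) powr q \<le> ((A * B) * (norm (l x) / A * (norm (v x) / B))) powr q"
      using exps by (intro powr_mono2) auto
    also have "\<dots> = (A * B) powr q * (norm (l x) / A * (norm (v x) / B)) powr q"
      by (simp only: powr_mult)
    also have "\<dots> \<le> (A * B) powr q * (q / r * (norm (l x) / A) powr r + q / p * (norm (v x) / B) powr p)"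
      using that exps by (intro mult_left_mono Young_powr) auto
    finally show ?case using that by (simp add: powr_divide)
  qed
  have hint: "integrable ?M (\<lambda>x. norm (h x) powr q)"
  proof (rule Bochner_Integration.integrable_bound)
    show "integrable ?M (\<lambda>x. (1 * 1) powr q *
        (q / r * (norm (l x) powr r / 1 powr r) + q / p * (norm (v x) powr p / 1 powr p)))"
      using int by (intro integrable_mult_right Bochner_Integration.integrable_add integrable_divide)
    show "AE x in ?M. norm (norm (h x) powr q) \<le> norm ((1 * 1) powr q *
        (q / r * (norm (l x) powr r / 1 powr r) + q / p * (norm (v x) powr p / 1 powr p)))"
      using pw[OF zero_less_one zero_less_one] by eventually_elim simp
  qed measurable
  with h show "h \<in> Lp_fun q a b" by (simp add: Lp_fun_def)
  have AB: "Lp_norm q a b h \<le> A * B" if A: "0 < A" "Lp_norm r a b l \<le> A" and B: "0 < B" "Lp_norm p a b v \<le> B" for A B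
  proof -
    have "q / r + q / p = q * (1 / p + 1 / r)" by (simp add: distrib_left)
    also have "\<dots> = 1" using exps(2) by (simp flip: exps(4))
    finally have one: "q / r + q / p = 1" .
    have "(\<integral>x. norm (h x) powr q \<partial>?M) \<le> (\<integral>x. (A * B) powr q *
      (q / r * (norm (l x) powr r / A powr r) + q / p * (norm (v x) powr p / B powr p)) \<partial>?M)"
      using hint int pw[OF A(1) B(1)] by (intro integral_mono_AE) auto
    also have "\<dots> = (A * B) powr q * (q / r * ((\<integral>x. norm (l x) powr r \<partial>?M) / A powr r)
        + q / p * ((\<integral>x. norm (v x) powr p \<partial>?M) / B powr p))"
      using int by simp
    also have "\<dots> \<le> (A * B) powr q * (q / r * 1 + q / p * 1)"
      using A B exps Lp_norm_le_iff[of r A a b l] Lp_norm_le_iff[of p B a b v]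
      by (intro mult_left_mono add_mono) auto
    finally show ?thesis using Lp_norm_le_iff[of q "A * B" a b h] exps A B one by simp
  qed
  have "((\<lambda>e. (Lp_norm r a b l + e) * (Lp_norm p a b v + e)) \<longlongrightarrow>
      (Lp_norm r a b l + 0) * (Lp_norm p a b v + 0)) (at_right 0)"
    by (intro tendsto_intros)
  moreover have "eventually (\<lambda>e. Lp_norm q a b h \<le> (Lp_norm r a b l + e) * (Lp_norm p a b v + e)) (at_right 0)"
    using eventually_at_right_less[of "0::real"]
    by eventually_elim (auto intro!: AB simp: Lp_norm_nonneg add_nonneg_pos)
  ultimately show "Lp_norm q a b h \<le> Lp_norm r a b l * Lp_norm p a b v"
    by (auto intro: tendsto_lowerbound)
qed

text \<open>A rapidly Cauchy subsequence converges almost everywhere, and Fatou's lemma carries the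
  Cauchy estimate of the full sequence over to the limit.\<close>

lemma Riesz_Fischer:
  fixes F :: "nat \<Rightarrow> real \<Rightarrow> 'e::banach"
  assumes p: "1 \<le> p" and F: "\<And>n. F n \<in> Lp_fun p a b"
    and cauchy: "\<And>e. 0 < e \<Longrightarrow> \<exists>N. \<forall>m\<ge>N. \<forall>n\<ge>N. Lp_norm p a b (\<lambda>x. F m x - F n x) < e"
  shows "\<exists>g\<in>Lp_fun p a b. \<forall>e>0. \<exists>N. \<forall>n\<ge>N. Lp_norm p a b (\<lambda>x. F n x - g x) < e"
proof -
  let ?M = "lebesgue_on {a<..<b}"
  have "\<forall>k::nat. \<exists>N. \<forall>m\<ge>N. \<forall>n\<ge>N. Lp_norm p a b (\<lambda>x. F m x - F n x) < (1/4) ^ k"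
    by (intro allI cauchy) simp
  then obtain \<phi> where \<phi>: "\<And>k m n. \<phi> k \<le> m \<Longrightarrow> \<phi> k \<le> n \<Longrightarrow> Lp_norm p a b (\<lambda>x. F m x - F n x) < (1/4) ^ k"
    by metis
  \<comment> \<open>The sum dominates every threshold \<open>\<phi> j\<close> with
    \<open>j \<le> k\<close>, so \<open>N k\<close> and \<open>N (Suc k)\<close> both obey the k-th
    estimate.\<close>
  define N where "N k = (\<Sum>i\<le>k. \<phi> i)" for k
  have N: "\<phi> j \<le> N k" if "j \<le> k" for j k
    using that by (auto simp: N_def intro: member_le_sum)
  have diff: "(\<lambda>x. F m x - F n x) \<in> Lp_fun p a b" for m n by (rule Lp_fun_diff[OF p F F])
  have [measurable]: "(\<lambda>x. F m x - F n x) \<in> borel_measurable ?M" for m n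
    using diff[of m n] by (auto simp: Lp_fun_def intro: bochner_measurable_imp_borel)
  have int: "integrable ?M (\<lambda>x. norm (F m x - F n x) powr p)" for m n
    using diff[of m n] by (simp add: Lp_fun_def)
  \<comment> \<open>The weight \<open>2 ^ k\<close> spends half of the decay
    \<open>(1/4) ^ k\<close>: the integrals remain summable, and weighted increments below 1 give
    increments of at most \<open>(1/2) ^ k\<close>.\<close>
  have "AE x in ?M. (\<lambda>k. (2 ^ k * norm (F (N (Suc k)) x - F (N k) x)) powr p) \<longlonglongrightarrow> 0"
  proof (rule AE_tendsto_0_if_nn_integral_le)
    fix k
    have "(\<integral>x. norm (F (N (Suc k)) x - F (N k) x) powr p \<partial>?M) < ((1/4) ^ k) powr p"
      using \<phi>[OF N N, of k "Suc k" k] by (subst Lp_norm_less_iff[OF p, symmetric]) auto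
    then have "(2 ^ k) powr p * (\<integral>x. norm (F (N (Suc k)) x - F (N k) x) powr p \<partial>?M) \<le>
        (2 ^ k) powr p * ((1/4) ^ k) powr p"
      by (intro mult_left_mono) auto
    also have "\<dots> = ((1/2) ^ k) powr p"
      by (simp add: powr_mult[symmetric] power_mult_distrib[symmetric])
    also have "\<dots> \<le> (1/2) ^ k"
      using powr_mono'[of 1 p "(1/2) ^ k"] p by (simp add: power_le_one)
    finally show "(\<integral>\<^sup>+x. ennreal ((2 ^ k * norm (F (N (Suc k)) x - F (N k) x)) powr p) \<partial>?M) \<le> ennreal ((1/2) ^ k)"
      using int by (subst nn_integral_eq_integral) (auto simp: powr_mult intro: ennreal_leI)
  qed auto
  then have conv: "AE x in ?M. convergent (\<lambda>k. F (N k) x)"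
  proof eventually_elim
    case (elim x)
    have "eventually (\<lambda>k. (2 ^ k * norm (F (N (Suc k)) x - F (N k) x)) powr p < 1) sequentially"
      using order_tendstoD(2)[OF elim] by simp
    then have "eventually (\<lambda>k. norm (F (N (Suc k)) x - F (N k) x) \<le> (1/2) ^ k) sequentially"
    proof eventually_elim
      case (elim k)
      then have "2 ^ k * norm (F (N (Suc k)) x - F (N k) x) < 1"
        using ge_one_powr_ge_zero[of "2 ^ k * norm (F (N (Suc k)) x - F (N k) x)" p] p by force
      then show ?case by (simp add: power_one_over field_simps)
    qed
    then have "summable (\<lambda>k. F (N (Suc k)) x - F (N k) x)"
      by (rule summable_comparison_test_ev) (auto intro!: summable_geometric)
    then have "convergent (\<lambda>n. \<Sum>k<n. F (N (Suc k)) x - F (N k) x)"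
      by (simp add: summable_iff_convergent)
    then have "convergent (\<lambda>n. (F (N n) x - F (N 0) x) + F (N 0) x)"
      by (subst (asm) sum_lessThan_telescope) (intro convergent_add convergent_const)
    then show ?case by simp
  qed
  define g where "g x = lim (\<lambda>k. F (N k) x)" for x
  have lim: "AE x in ?M. (\<lambda>k. F (N k) x) \<longlonglongrightarrow> g x"
    using conv by eventually_elim (simp add: g_def convergent_LIMSEQ_iff)
  have Fm: "bochner_measurable a b (F n)" for n
    using F[of n] by (simp add: Lp_fun_def)
  have gm: "bochner_measurable a b g"
    by (rule bochner_measurable_LIMSEQ_AE[OF Fm lim])
  have dm: "bochner_measurable a b (\<lambda>x. F n x - g x)" for n
    by (rule bochner_measurable_diff[OF Fm gm])
  have [measurable]: "(\<lambda>x. F n x - g x) \<in> borel_measurable ?M" for n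
    by (rule bochner_measurable_imp_borel[OF dm])
  have fatou: "(\<integral>\<^sup>+x. ennreal (norm (F n x - g x) powr p) \<partial>?M) \<le> ennreal (((1/4) ^ j) powr p)"
    if "\<phi> j \<le> n" for n j
  proof -
    have "(\<integral>\<^sup>+x. ennreal (norm (F n x - g x) powr p) \<partial>?M) =
        (\<integral>\<^sup>+x. liminf (\<lambda>k. ennreal (norm (F n x - F (N k) x) powr p)) \<partial>?M)"
    proof (rule nn_integral_cong_AE)
      show "AE x in ?M. ennreal (norm (F n x - g x) powr p) = liminf (\<lambda>k. ennreal (norm (F n x - F (N k) x) powr p))"
        using lim
      proof eventually_elim
        case (elim x)
        have "(\<lambda>k. ennreal (norm (F n x - F (N k) x) powr p)) \<longlonglongrightarrow> ennreal (norm (F n x - g x) powr p)"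
          using elim p by (intro tendsto_ennrealI tendsto_powr' tendsto_intros) auto
        then show ?case by (intro lim_imp_Liminf[symmetric]) simp_all
      qed
    qed
    also have "\<dots> \<le> liminf (\<lambda>k. \<integral>\<^sup>+x. ennreal (norm (F n x - F (N k) x) powr p) \<partial>?M)"
      by (rule nn_integral_liminf) measurable
    also have "\<dots> \<le> ennreal (((1/4) ^ j) powr p)"
    proof (rule Liminf_le)
      have "eventually (\<lambda>k. j \<le> k) sequentially" by (rule eventually_ge_at_top)
      then show "eventually (\<lambda>k. (\<integral>\<^sup>+x. ennreal (norm (F n x - F (N k) x) powr p) \<partial>?M)
          \<le> ennreal (((1/4) ^ j) powr p)) sequentially"
      proof eventually_elim
        case (elim k)
        have "(\<integral>x. norm (F n x - F (N k) x) powr p \<partial>?M) < ((1/4) ^ j) powr p"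
          using \<phi>[OF that N[OF elim]] by (subst Lp_norm_less_iff[OF p, symmetric]) auto
        then show ?case
          using int by (subst nn_integral_eq_integral) (auto intro: ennreal_leI)
      qed
    qed simp
    finally show ?thesis .
  qed
  have dint: "integrable ?M (\<lambda>x. norm (F n x - g x) powr p)" if "\<phi> j \<le> n" for n j
  proof (rule integrableI_bounded)
    show "(\<integral>\<^sup>+x. ennreal (norm (norm (F n x - g x) powr p)) \<partial>?M) < \<infinity>"
      using le_less_trans[OF fatou[OF that]] by (simp add: ennreal_less_top)
  qed measurable
  have "(\<lambda>x. F (\<phi> 0) x - g x) \<in> Lp_fun p a b"
    using dint[of 0 "\<phi> 0"] dm[of "\<phi> 0"] by (simp add: Lp_fun_def)
  from Lp_fun_diff[OF p F[of "\<phi> 0"] this] have g: "g \<in> Lp_fun p a b" by simp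
  show ?thesis
  proof (intro bexI[OF _ g] allI impI)
    fix e :: real assume "0 < e"
    then obtain j where j: "(1/4) ^ j < e" using real_arch_pow_inv[of e "1/4"] by auto
    have "Lp_norm p a b (\<lambda>x. F n x - g x) < e" if "\<phi> j \<le> n" for n
    proof -
      have "(\<integral>x. norm (F n x - g x) powr p \<partial>?M) \<le> ((1/4) ^ j) powr p"
        using fatou[OF that] dint[OF that] by (subst (asm) nn_integral_eq_integral) auto
      then have "Lp_norm p a b (\<lambda>x. F n x - g x) \<le> (1/4) ^ j"
        by (subst Lp_norm_le_iff[OF p]) auto
      then show ?thesis using j by simp
    qed
    then show "\<exists>N. \<forall>n\<ge>N. Lp_norm p a b (\<lambda>x. F n x - g x) < e" by blast
  qed
qed

section \<open>Translation of intervals and of functions on them\<close>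

lemma distr_lebesgue_translation: "distr lebesgue lebesgue ((+) t) = (lebesgue :: real measure)"
  using lebesgue_real_affine[of 1 t] by (simp add: density_1)

lemma measurable_lebesgue_translation: "(+) t \<in> lebesgue \<rightarrow>\<^sub>M (lebesgue :: real measure)"
  using lebesgue_affine_measurable[of "\<lambda>_. 1" t] by (simp add: scaleR_conv_of_real)

lemma measurable_interval_translation:
  "(+) t \<in> lebesgue_on {a<..<b} \<rightarrow>\<^sub>M lebesgue_on {t + a<..<t + b::real}"
  by (intro measurable_restrict_space3 measurable_lebesgue_translation) auto

lemma distr_interval_translation:
  "distr (lebesgue_on {a<..<b}) (lebesgue_on {t + a<..<t + b}) ((+) t) = lebesgue_on {t + a<..<t + b::real}"
proof (rule measure_eqI)
  fix A assume "A \<in> sets (distr (lebesgue_on {a<..<b}) (lebesgue_on {t + a<..<t + b}) ((+) t))"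
  then have A: "A \<in> sets (lebesgue_on {t + a<..<t + b})" by simp
  then have A': "A \<in> sets lebesgue" "A \<subseteq> {t + a<..<t + b}" by (auto simp: sets_restrict_space_iff)
  have eq: "(+) t -` A \<inter> {a<..<b} = (+) t -` A \<inter> space lebesgue" using A'(2) by auto
  have "emeasure (distr (lebesgue_on {a<..<b}) (lebesgue_on {t + a<..<t + b}) ((+) t)) A =
      emeasure (lebesgue_on {a<..<b}) ((+) t -` A \<inter> {a<..<b})"
    using emeasure_distr[OF measurable_interval_translation A] by simp
  also have "\<dots> = emeasure lebesgue ((+) t -` A \<inter> {a<..<b})"
    by (intro emeasure_restrict_space) auto
  also have "\<dots> = emeasure (distr lebesgue lebesgue ((+) t)) A"
    using emeasure_distr[OF measurable_lebesgue_translation A'(1)] eq by simp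
  also have "\<dots> = emeasure (lebesgue_on {t + a<..<t + b}) A"
    using A'(2) by (subst distr_lebesgue_translation, subst emeasure_restrict_space) auto
  finally show "emeasure (distr (lebesgue_on {a<..<b}) (lebesgue_on {t + a<..<t + b}) ((+) t)) A =
      emeasure (lebesgue_on {t + a<..<t + b}) A" .
qed simp

lemma AE_interval_translation:
  assumes "AE x in lebesgue_on {t + a<..<t + b}. P x"
  shows "AE x in lebesgue_on {a<..<b::real}. P (t + x)"
  using AE_distrD[OF measurable_interval_translation, of P] assms
  by (simp only: distr_interval_translation)

lemma Lp_fun_translation:
  fixes u :: "real \<Rightarrow> 'e::banach"
  assumes u: "u \<in> Lp_fun p (t + a) (t + b)"
  shows "(\<lambda>x. u (t + x)) \<in> Lp_fun p a b"
proof -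
  obtain s where s: "\<And>i::nat. simple_function (lebesgue_on {t + a<..<t + b}) (s i)"
    and lim: "AE x in lebesgue_on {t + a<..<t + b}. (\<lambda>i. s i x) \<longlonglongrightarrow> u x"
    using u unfolding Lp_fun_def bochner_measurable_def by blast
  have "bochner_measurable a b (\<lambda>x. u (t + x))"
    unfolding bochner_measurable_def
    using simple_function_comp[OF measurable_interval_translation s] AE_interval_translation[OF lim]
    by (intro exI[of _ "\<lambda>i x. s i (t + x)"]) auto
  moreover have "integrable (lebesgue_on {a<..<b}) (\<lambda>x. norm (u (t + x)) powr p)"
    using u integrable_distr[OF measurable_interval_translation[where a = a and b = b and t = t],
      of "\<lambda>x. norm (u x) powr p"]
    by (simp add: distr_interval_translation Lp_fun_def)
  ultimately show ?thesis by (simp add: Lp_fun_def)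
qed

section \<open>Superposition operators between $L^p$ spaces\<close>

text \<open>The problem on a single interval, to be used with \<open>f (t + \<theta>, x)\<close> as
  \<open>g \<theta> x\<close> and with the translate of \<open>L\<close> as
  \<open>l\<close>.\<close>

locale Lp_superposition =
  fixes p q r a b :: real and l :: "real \<Rightarrow> real" and g :: "real \<Rightarrow> 'x::banach \<Rightarrow> 'y::banach"
  assumes exps: "1 \<le> p" "1 \<le> q" "1 \<le> r" "1 / q = 1 / p + 1 / r"
    and l: "l \<in> Lp_fun r a b"
    and lip: "AE t in lebesgue_on {a<..<b}. \<forall>x y. norm (g t x - g t y) \<le> l t * norm (x - y)"
    and g: "\<And>x. (\<lambda>t. g t x) \<in> Lp_fun q a b"
begin

text \<open>Measurability is given only for fixed second argument. On the level set of
  \<open>\<phi>\<close> at \<open>x\<close> the approximants of the section at \<open>x\<close> are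
  used; finitely many level sets glue to a simple function.\<close>

lemma bochner_measurable_superposition_simple:
  assumes \<phi>: "simple_function (lebesgue_on {a<..<b}) \<phi>"
  shows "bochner_measurable a b (\<lambda>t. g t (\<phi> t))"
proof -
  let ?M = "lebesgue_on {a<..<b}"
  have "\<forall>x. \<exists>s. (\<forall>i::nat. simple_function ?M (s i)) \<and> (AE t in ?M. (\<lambda>i. s i t) \<longlonglongrightarrow> g t x)"
    using g unfolding Lp_fun_def bochner_measurable_def by blast
  then have "\<exists>s. \<forall>x. (\<forall>i::nat. simple_function ?M (s x i)) \<and> (AE t in ?M. (\<lambda>i. s x i t) \<longlonglongrightarrow> g t x)"
    by (rule choice)
  then obtain s where s: "\<And>x. \<And>i::nat. simple_function ?M (s x i)"
    and lim: "\<And>x. AE t in ?M. (\<lambda>i. s x i t) \<longlonglongrightarrow> g t x" by blast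
  have fin: "finite (\<phi> ` {a<..<b})" using simple_functionD(1)[OF \<phi>] by simp
  have "simple_function ?M (\<lambda>t. s (\<phi> t) i t)" for i
    unfolding simple_function_def
  proof (intro conjI ballI)
    have "finite (\<Union>x\<in>\<phi> ` {a<..<b}. s x i ` {a<..<b})"
      using simple_functionD(1)[OF s] by (intro finite_UN_I fin) simp
    then show "finite ((\<lambda>t. s (\<phi> t) i t) ` space ?M)" by (rule finite_subset[rotated]) auto
    fix y
    have "(\<lambda>t. s (\<phi> t) i t) -` {y} \<inter> space ?M =
        (\<Union>x\<in>\<phi> ` {a<..<b}. (\<phi> -` {x} \<inter> space ?M) \<inter> (s x i -` {y} \<inter> space ?M))"
      by auto
    also have "\<dots> \<in> sets ?M"
      by (rule sets.finite_UN[OF fin], rule sets.Int)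
        (rule simple_functionD(2)[OF \<phi>], rule simple_functionD(2)[OF s])
    finally show "(\<lambda>t. s (\<phi> t) i t) -` {y} \<inter> space ?M \<in> sets ?M" .
  qed
  moreover have "AE t in ?M. (\<lambda>i. s (\<phi> t) i t) \<longlonglongrightarrow> g t (\<phi> t)"
  proof -
    \<comment> \<open>The exceptional null set depends on \<open>x\<close>; only finitely many of
      them have to be united.\<close>
    have "AE t in ?M. \<forall>x\<in>\<phi> ` {a<..<b}. (\<lambda>i. s x i t) \<longlonglongrightarrow> g t x"
      using lim by (intro AE_finite_allI fin) auto
    then show ?thesis using AE_space by eventually_elim auto
  qed
  ultimately show ?thesis
    unfolding bochner_measurable_def by (intro exI[of _ "\<lambda>i t. s (\<phi> t) i t"]) auto
qed

text \<open>The Lipschitz condition passes from simple approximants of \<open>v\<close> to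
  \<open>v\<close>, which takes the place of joint measurability of \<open>g\<close>.\<close>

lemma bochner_measurable_superposition:
  assumes v: "v \<in> Lp_fun p a b"
  shows "bochner_measurable a b (\<lambda>t. g t (v t))"
proof -
  let ?M = "lebesgue_on {a<..<b}"
  obtain s where s: "\<And>i::nat. simple_function ?M (s i)"
    and lim: "AE t in ?M. (\<lambda>i. s i t) \<longlonglongrightarrow> v t"
    using v unfolding Lp_fun_def bochner_measurable_def by blast
  show ?thesis
  proof (rule bochner_measurable_LIMSEQ_AE)
    show "bochner_measurable a b (\<lambda>t. g t (s i t))" for i
      by (rule bochner_measurable_superposition_simple[OF s])
    show "AE t in ?M. (\<lambda>i. g t (s i t)) \<longlonglongrightarrow> g t (v t)"
      using lim lip
    proof eventually_elim
      case (elim t)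
      have "(\<lambda>i. l t * norm (s i t - v t)) \<longlonglongrightarrow> l t * norm (v t - v t)"
        by (intro tendsto_intros elim(1))
      then have "(\<lambda>i. l t * norm (s i t - v t)) \<longlonglongrightarrow> 0" by simp
      moreover have "eventually (\<lambda>i. norm (g t (s i t) - g t (v t)) \<le> l t * norm (s i t - v t)) sequentially"
        using elim(2) by (intro always_eventually allI) blast
      ultimately have "(\<lambda>i. g t (s i t) - g t (v t)) \<longlonglongrightarrow> 0"
        by (rule Lim_null_comparison[rotated])
      then show ?case by (rule LIM_zero_cancel)
    qed
  qed
qed

lemma
  assumes v: "v \<in> Lp_fun p a b" and w: "w \<in> Lp_fun p a b"
  shows Lp_fun_superposition_diff: "(\<lambda>t. g t (v t) - g t (w t)) \<in> Lp_fun q a b"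
    and Lp_norm_superposition_diff:
      "Lp_norm q a b (\<lambda>t. g t (v t) - g t (w t)) \<le> Lp_norm r a b l * Lp_norm p a b (\<lambda>t. v t - w t)"
proof -
  have "bochner_measurable a b (\<lambda>t. g t (v t) - g t (w t))"
    by (intro bochner_measurable_diff bochner_measurable_superposition v w)
  moreover have "AE t in lebesgue_on {a<..<b}. norm (g t (v t) - g t (w t)) \<le> l t * norm (v t - w t)"
    using lip by eventually_elim simp
  ultimately show "(\<lambda>t. g t (v t) - g t (w t)) \<in> Lp_fun q a b"
    "Lp_norm q a b (\<lambda>t. g t (v t) - g t (w t)) \<le> Lp_norm r a b l * Lp_norm p a b (\<lambda>t. v t - w t)"
    by (intro Holder_Lp[OF exps l Lp_fun_diff[OF exps(1) v w]]; simp)+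
qed

text \<open>Hoelder's inequality handles differences of superpositions; the section at 0 supplies a
  reference function.\<close>

lemma Lp_fun_superposition:
  assumes v: "v \<in> Lp_fun p a b"
  shows "(\<lambda>t. g t (v t)) \<in> Lp_fun q a b"
proof -
  have 0: "(\<lambda>_. 0) \<in> Lp_fun p a b" by (rule Lp_fun_simple) simp
  have "(\<lambda>t. g t 0 - (g t 0 - g t (v t))) \<in> Lp_fun q a b"
    by (intro Lp_fun_diff[OF exps(2)] g Lp_fun_superposition_diff[OF 0 v])
  then show ?thesis by simp
qed

end

text \<open>At each \<open>t\<close> the integrand is one of finitely many summands, the one with
  \<open>x = \<phi> t\<close>, so the sum over the whole range of \<open>\<phi>\<close> dominates
  it.\<close>

lemma Lp_norm_superposition_simple_diff:
  fixes g h :: "real \<Rightarrow> 'x \<Rightarrow> 'y::banach"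
  assumes q: "1 \<le> q" and g: "\<And>x. (\<lambda>t. g t x) \<in> Lp_fun q a b" and h: "\<And>x. (\<lambda>t. h t x) \<in> Lp_fun q a b"
    and \<phi>: "finite (\<phi> ` {a<..<b})" and int: "(\<lambda>t. g t (\<phi> t) - h t (\<phi> t)) \<in> Lp_fun q a b"
    and \<delta>: "0 < \<delta>" "\<And>x. x \<in> \<phi> ` {a<..<b} \<Longrightarrow> Lp_norm q a b (\<lambda>t. g t x - h t x) < \<delta>"
  shows "Lp_norm q a b (\<lambda>t. g t (\<phi> t) - h t (\<phi> t)) \<le> (real (card (\<phi> ` {a<..<b})) + 1) * \<delta>"
proof -
  let ?M = "lebesgue_on {a<..<b}" and ?n = "real (card (\<phi> ` {a<..<b})) + 1"
  have ints: "integrable ?M (\<lambda>t. norm (g t x - h t x) powr q)" for x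
    using Lp_fun_diff[OF q g h, of x x] by (simp add: Lp_fun_def)
  have "(\<integral>t. norm (g t (\<phi> t) - h t (\<phi> t)) powr q \<partial>?M) \<le>
      (\<integral>t. (\<Sum>x\<in>\<phi> ` {a<..<b}. norm (g t x - h t x) powr q) \<partial>?M)"
  proof (rule integral_mono)
    show "integrable ?M (\<lambda>t. norm (g t (\<phi> t) - h t (\<phi> t)) powr q)" using int by (simp add: Lp_fun_def)
    show "integrable ?M (\<lambda>t. \<Sum>x\<in>\<phi> ` {a<..<b}. norm (g t x - h t x) powr q)"
      using ints by (intro Bochner_Integration.integrable_sum)
    show "norm (g t (\<phi> t) - h t (\<phi> t)) powr q \<le> (\<Sum>x\<in>\<phi> ` {a<..<b}. norm (g t x - h t x) powr q)"
      if "t \<in> space ?M" for t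
      using that \<phi> by (intro member_le_sum[where f = "\<lambda>x. norm (g t x - h t x) powr q"]) auto
  qed
  also have "\<dots> = (\<Sum>x\<in>\<phi> ` {a<..<b}. \<integral>t. norm (g t x - h t x) powr q \<partial>?M)"
    using ints by (intro Bochner_Integration.integral_sum)
  also have "\<dots> \<le> (\<Sum>x\<in>\<phi> ` {a<..<b}. \<delta> powr q)"
    using iffD1[OF Lp_norm_less_iff[OF q \<delta>(1)] \<delta>(2)] by (intro sum_mono less_imp_le)
  also have "\<dots> \<le> ?n * \<delta> powr q"
    by (simp add: mult_right_mono)
  \<comment> \<open>The summand 1 gives \<open>1 \<le> ?n\<close> even for an empty range, so the
    count can be moved inside the power.\<close>
  also have "\<dots> \<le> ?n powr q * \<delta> powr q"
    using powr_mono[of 1 q ?n] q by (intro mult_right_mono) auto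
  also have "\<dots> = (?n * \<delta>) powr q"
    by (rule powr_mult[symmetric])
  finally show ?thesis using \<delta>(1) by (subst Lp_norm_le_iff[OF q]) auto
qed

section \<open>Nemytskii operators on Stepanov spaces\<close>

lemma limitin_mtopology_of:
  "limitin (mtopology_of m) f l F \<longleftrightarrow>
    l \<in> mspace m \<and> (\<forall>e>0. eventually (\<lambda>x. f x \<in> mspace m \<and> mdist m (f x) l < e) F)"
  unfolding mtopology_of_def by (rule Metric_space.limitin_metric[OF Metric_space_mspace_mdist])

lemma line_pseudometric_mdist:
  assumes "range u \<subseteq> mspace m"
  shows "line_pseudometric (\<lambda>s t. mdist m (u s) (u t))"
proof
  have um: "u t \<in> mspace m" for t using assms by blast
  show "mdist m (u t) (u t) = 0" for t using um by simp
  show "mdist m (u s) (u t) = mdist m (u t) (u s)" for s t by (rule mdist_commute)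
  show "mdist m (u s) (u v) \<le> mdist m (u s) (u t) + mdist m (u t) (u v)" for s t v
    by (rule mdist_triangle[OF um um um])
qed

lemma continuous_map_iff_line_continuous:
  assumes u: "range u \<subseteq> mspace m"
  shows "continuous_map euclidean (mtopology_of m) u \<longleftrightarrow> line_continuous (\<lambda>s t. mdist m (u s) (u t))"
proof -
  have *: "(\<exists>U. open U \<and> t \<in> U \<and> (\<forall>s\<in>U. mdist m (u s) (u t) < e)) \<longleftrightarrow>
      (\<exists>h>0. \<forall>s. \<bar>s - t\<bar> < h \<longrightarrow> mdist m (u s) (u t) < e)" (is "?L \<longleftrightarrow> ?R") for t e
  proof
    assume ?L
    then obtain U where U: "open U" "t \<in> U" "\<forall>s\<in>U. mdist m (u s) (u t) < e" by blast
    then obtain h where "0 < h" "ball t h \<subseteq> U" using openE by blast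
    with U(3) show ?R by (intro exI[of _ h]) (auto simp: dist_real_def abs_minus_commute subset_iff)
  next
    assume ?R
    then obtain h where "0 < h" "\<forall>s. \<bar>s - t\<bar> < h \<longrightarrow> mdist m (u s) (u t) < e" by blast
    then show ?L by (intro exI[of _ "ball t h"]) (auto simp: dist_real_def abs_minus_commute)
  qed
  show ?thesis
    unfolding mtopology_of_def Metric_space.continuous_map_to_metric[OF Metric_space_mspace_mdist]
      line_continuous_def *[symmetric]
    using u by (simp add: Metric_space.in_mball[OF Metric_space_mspace_mdist] mdist_commute
        image_subset_iff)
qed

lemma AP_iff_line_ap:
  assumes "range u \<subseteq> mspace m"
  shows "u \<in> AP m \<longleftrightarrow> line_ap (\<lambda>s t. mdist m (u s) (u t))"
  unfolding AP_def line_ap_def using continuous_map_iff_line_continuous[OF assms] by simp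

text \<open>For fixed \<open>k\<close>, \<open>v (t - s k)\<close> is the limit in \<open>j\<close>
  of \<open>u (t - s k + s j)\<close>, which eliminates \<open>v\<close> from the second
  limit.\<close>

lemma aa_sequence_if_limits:
  assumes u: "range u \<subseteq> mspace m"
    and lim: "\<And>t. limitin (mtopology_of m) (\<lambda>k. u (t + s k)) (v t) sequentially"
      "\<And>t. limitin (mtopology_of m) (\<lambda>k. v (t - s k)) (u t) sequentially"
  shows "aa_sequence (\<lambda>s t. mdist m (u s) (u t)) s"
  unfolding aa_sequence_def
proof (intro conjI allI impI)
  have um: "u t \<in> mspace m" for t using u by blast
  have vm: "v t \<in> mspace m" for t using lim(1)[of t] by (simp add: limitin_mtopology_of)
  have ev1: "\<exists>K. \<forall>k\<ge>K. mdist m (u (t + s k)) (v t) < e" if "0 < e" for t e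
    using lim(1)[of t] that unfolding limitin_mtopology_of eventually_sequentially by blast
  have ev2: "\<exists>K. \<forall>k\<ge>K. mdist m (v (t - s k)) (u t) < e" if "0 < e" for t e
    using lim(2)[of t] that unfolding limitin_mtopology_of eventually_sequentially by blast
  fix t e :: real assume "0 < e"
  then have e: "0 < e / 2" by simp
  obtain K where K: "\<And>k. K \<le> k \<Longrightarrow> mdist m (u (t + s k)) (v t) < e / 2" using ev1[OF e] by blast
  have "mdist m (u (t + s j)) (u (t + s k)) < e" if "K \<le> j" "K \<le> k" for j k
    using K[OF that(1)] K[OF that(2)] mdist_triangle[OF um[of "t + s j"] vm[of t] um[of "t + s k"]]
      mdist_commute[of m "v t" "u (t + s k)"] by linarith
  then show "\<exists>K. \<forall>j\<ge>K. \<forall>k\<ge>K. mdist m (u (t + s j)) (u (t + s k)) < e" by blast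
  obtain K where K: "\<And>k. K \<le> k \<Longrightarrow> mdist m (v (t - s k)) (u t) < e / 2" using ev2[OF e] by blast
  have "\<exists>J. \<forall>j\<ge>J. mdist m (u (t - s k + s j)) (u t) < e" if k: "K \<le> k" for k
  proof -
    obtain J where J: "\<And>j. J \<le> j \<Longrightarrow> mdist m (u (t - s k + s j)) (v (t - s k)) < e / 2"
      using ev1[OF e] by blast
    have "mdist m (u (t - s k + s j)) (u t) < e" if "J \<le> j" for j
      using J[OF that] K[OF k] mdist_triangle[OF um[of "t - s k + s j"] vm[of "t - s k"] um[of t]]
      by linarith
    then show ?thesis by blast
  qed
  then show "\<exists>K. \<forall>k\<ge>K. \<exists>J. \<forall>j\<ge>J. mdist m (u (t - s k + s j)) (u t) < e" by blast
qed

lemma limits_if_aa_sequence: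
  assumes m: "mcomplete_of m" and u: "range u \<subseteq> mspace m"
    and s: "aa_sequence (\<lambda>s t. mdist m (u s) (u t)) s"
  shows "\<exists>v. \<forall>t. limitin (mtopology_of m) (\<lambda>k. u (t + s k)) (v t) sequentially \<and>
      limitin (mtopology_of m) (\<lambda>k. v (t - s k)) (u t) sequentially"
proof -
  have um: "u t \<in> mspace m" for t using u by blast
  have "\<exists>y. limitin (mtopology_of m) (\<lambda>k. u (t + s k)) y sequentially" for t
  proof -
    have "Metric_space.MCauchy (mspace m) (mdist m) (\<lambda>k. u (t + s k))"
      unfolding Metric_space.MCauchy_def[OF Metric_space_mspace_mdist]
    proof (intro conjI allI impI)
      show "range (\<lambda>k. u (t + s k)) \<subseteq> mspace m" using um by blast
      fix e :: real assume "0 < e"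
      then obtain K where "\<forall>j\<ge>K. \<forall>k\<ge>K. mdist m (u (t + s j)) (u (t + s k)) < e"
        using s unfolding aa_sequence_def by blast
      then show "\<exists>N. \<forall>n n'. N \<le> n \<longrightarrow> N \<le> n' \<longrightarrow> mdist m (u (t + s n)) (u (t + s n')) < e"
        by (intro exI[of _ K]) simp
    qed
    then show ?thesis
      using m unfolding mcomplete_of_def mtopology_of_def
        Metric_space.mcomplete_def[OF Metric_space_mspace_mdist] by blast
  qed
  then have "\<exists>v. \<forall>t. limitin (mtopology_of m) (\<lambda>k. u (t + s k)) (v t) sequentially"
    by (intro choice allI)
  then obtain v where v: "\<And>t. limitin (mtopology_of m) (\<lambda>k. u (t + s k)) (v t) sequentially" by blast
  have vm: "v t \<in> mspace m" for t using v[of t] by (simp add: limitin_mtopology_of)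
  have ev: "\<exists>K. \<forall>k\<ge>K. mdist m (u (t + s k)) (v t) < e" if "0 < e" for t e
    using v[of t] that unfolding limitin_mtopology_of eventually_sequentially by blast
  have "limitin (mtopology_of m) (\<lambda>k. v (t - s k)) (u t) sequentially" for t
    unfolding limitin_mtopology_of
  proof (intro conjI allI impI)
    show "u t \<in> mspace m" by (rule um)
    fix e :: real assume "0 < e"
    then have e: "0 < e / 2" by simp
    obtain K where K: "\<And>k. K \<le> k \<Longrightarrow> \<exists>J. \<forall>j\<ge>J. mdist m (u (t - s k + s j)) (u t) < e / 2"
      using s e unfolding aa_sequence_def by meson
    have "mdist m (v (t - s k)) (u t) < e" if k: "K \<le> k" for k
    proof -
      obtain J where J: "\<And>j. J \<le> j \<Longrightarrow> mdist m (u (t - s k + s j)) (u t) < e / 2"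
        using K[OF k] by blast
      obtain I where I: "\<And>j. I \<le> j \<Longrightarrow> mdist m (u (t - s k + s j)) (v (t - s k)) < e / 2"
        using ev[OF e] by blast
      \<comment> \<open>This index merely links \<open>v (t - s k)\<close> to \<open>u t\<close> and
        may depend on \<open>k\<close>.\<close>
      define j where "j = max I J"
      have "mdist m (u (t - s k + s j)) (u t) < e / 2" "mdist m (u (t - s k + s j)) (v (t - s k)) < e / 2"
        using I[of j] J[of j] unfolding j_def by linarith+
      then show ?thesis
        using mdist_triangle[OF vm[of "t - s k"] um[of "t - s k + s j"] um[of t]]
          mdist_commute[of m "v (t - s k)" "u (t - s k + s j)"] by linarith
    qed
    then show "eventually (\<lambda>k. v (t - s k) \<in> mspace m \<and> mdist m (v (t - s k)) (u t) < e) sequentially"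
      using vm unfolding eventually_sequentially by blast
  qed
  with v show ?thesis by blast
qed

lemma AA_iff_line_aa:
  assumes "mcomplete_of m" "range u \<subseteq> mspace m"
  shows "u \<in> AA m \<longleftrightarrow> line_aa (\<lambda>s t. mdist m (u s) (u t))"
proof -
  have "aa_sequence (\<lambda>s t. mdist m (u s) (u t)) (s \<circ> \<phi>) \<longleftrightarrow>
      (\<exists>v. \<forall>t. limitin (mtopology_of m) (\<lambda>k. u (t + s (\<phi> k))) (v t) sequentially \<and>
        limitin (mtopology_of m) (\<lambda>k. v (t - s (\<phi> k))) (u t) sequentially)"
    for s and \<phi> :: "nat \<Rightarrow> nat"
    using aa_sequence_if_limits[OF assms(2), of "s \<circ> \<phi>"] limits_if_aa_sequence[OF assms, of "s \<circ> \<phi>"]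
    unfolding comp_apply by blast
  then show ?thesis
    unfolding AA_def line_aa_def
    using continuous_map_iff_line_continuous[OF assms(2)] by simp
qed

lemma mcomplete_of_Lp_metric:
  assumes p: "1 \<le> p"
  shows "mcomplete_of (Lp_metric p a b :: (real \<Rightarrow> 'e::banach) set metric)"
  unfolding mcomplete_of_def Metric_space.mcomplete_def[OF Metric_space_mspace_mdist]
proof (intro allI impI)
  let ?m = "Lp_metric p a b :: (real \<Rightarrow> 'e) set metric"
  fix \<sigma> assume \<sigma>: "Metric_space.MCauchy (mspace ?m) (mdist ?m) \<sigma>"
  then have "range \<sigma> \<subseteq> mspace ?m" by (simp add: Metric_space.MCauchy_def[OF Metric_space_mspace_mdist])
  then have "\<forall>n. \<exists>f. f \<in> Lp_fun p a b \<and> \<sigma> n = Lp_class p a b f"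
    unfolding mspace_Lp_metric[OF p] by blast
  then obtain F where F: "\<And>n. F n \<in> Lp_fun p a b" "\<And>n. \<sigma> n = Lp_class p a b (F n)" by metis
  have "\<exists>N. \<forall>m\<ge>N. \<forall>n\<ge>N. Lp_norm p a b (\<lambda>x. F m x - F n x) < e" if "0 < e" for e
    using \<sigma> that unfolding Metric_space.MCauchy_def[OF Metric_space_mspace_mdist]
    by (simp add: F mdist_Lp_metric[OF p])
  from Riesz_Fischer[OF p F(1) this] obtain g where g: "g \<in> Lp_fun p a b"
    "\<And>e. 0 < e \<Longrightarrow> \<exists>N. \<forall>n\<ge>N. Lp_norm p a b (\<lambda>x. F n x - g x) < e"
    by blast
  have "limitin (mtopology_of ?m) \<sigma> (Lp_class p a b g) sequentially"
    using g F(1) by (auto simp: limitin_mtopology_of F(2) mdist_Lp_metric[OF p] mspace_Lp_metric[OF p]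
        eventually_sequentially)
  then show "\<exists>x. limitin (Metric_space.mtopology (mspace ?m) (mdist ?m)) \<sigma> x sequentially"
    unfolding mtopology_of_def by blast
qed

section \<open>Stepanov spaces through the distance between unit windows\<close>

definition stepanov_dist :: "real \<Rightarrow> (real \<Rightarrow> 'e::banach) \<Rightarrow> real \<Rightarrow> real \<Rightarrow> real" where
  "stepanov_dist p u s t = Lp_norm p 0 1 (\<lambda>\<theta>. u (s + \<theta>) - u (t + \<theta>))"

lemma Lp_loc_translation:
  "u \<in> Lp_loc p \<Longrightarrow> (\<lambda>\<theta>. u (t + \<theta>)) \<in> Lp_fun p a b"
  by (rule Lp_fun_translation) (simp add: Lp_loc_def)

lemma mdist_bochner_transform:
  assumes "1 \<le> p" "u \<in> Lp_loc p"
  shows "mdist (Lp_metric p 0 1) (bochner_transform p u s) (bochner_transform p u t) = stepanov_dist p u s t"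
  using assms by (simp add: bochner_transform_def stepanov_dist_def mdist_Lp_metric Lp_loc_translation)

lemma range_bochner_transform:
  assumes "1 \<le> p" "u \<in> Lp_loc p"
  shows "range (bochner_transform p u) \<subseteq> mspace (Lp_metric p 0 1)"
  using assms by (auto simp: bochner_transform_def mspace_Lp_metric intro: Lp_loc_translation)

lemma line_pseudometric_stepanov_dist:
  assumes "1 \<le> p" "u \<in> Lp_loc p"
  shows "line_pseudometric (stepanov_dist p u)"
  using line_pseudometric_mdist[OF range_bochner_transform[OF assms]]
  by (simp add: mdist_bochner_transform[OF assms])

lemma Sp_ap_iff:
  assumes "1 \<le> p"
  shows "u \<in> Sp_ap p \<longleftrightarrow> u \<in> Lp_loc p \<and> line_ap (stepanov_dist p u)"
proof (cases "u \<in> Lp_loc p")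
  case True
  then show ?thesis
    using AP_iff_line_ap[OF range_bochner_transform[OF assms True]]
    by (simp add: Sp_ap_def mdist_bochner_transform[OF assms True])
qed (simp add: Sp_ap_def)

lemma Sp_aa_iff:
  assumes "1 \<le> p"
  shows "u \<in> Sp_aa p \<longleftrightarrow> u \<in> Lp_loc p \<and> line_aa (stepanov_dist p u)"
proof (cases "u \<in> Lp_loc p")
  case True
  then show ?thesis
    using AA_iff_line_aa[OF mcomplete_of_Lp_metric[OF assms] range_bochner_transform[OF assms True]]
    by (simp add: Sp_aa_def mdist_bochner_transform[OF assms True])
qed (simp add: Sp_aa_def)

text \<open>What the almost automorphic and the almost periodic case share: each window is bounded
  by \<open>Sp_norm\<close>. Continuity of the operator is proved once from this.\<close>

definition stepanov_bounded :: "real \<Rightarrow> (real \<Rightarrow> 'e::banach) \<Rightarrow> bool" where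
  "stepanov_bounded p u \<longleftrightarrow> u \<in> Lp_loc p \<and> bdd_above (range (\<lambda>t. Lp_norm p 0 1 (\<lambda>\<theta>. u (t + \<theta>))))"

lemma stepanov_boundedI:
  assumes p: "1 \<le> p" and u: "u \<in> Lp_loc p" and B: "\<exists>B. \<forall>t. stepanov_dist p u t 0 \<le> B"
  shows "stepanov_bounded p u"
proof -
  obtain B where B: "\<And>t. stepanov_dist p u t 0 \<le> B" using B by blast
  \<comment> \<open>\<open>Lp_norm_minkowski\<close> speaks of differences, so the norm of a window
    is read as its distance from the zero function.\<close>
  have 0: "(\<lambda>_. 0) \<in> Lp_fun p 0 1" by (rule Lp_fun_simple) simp
  have "Lp_norm p 0 1 (\<lambda>\<theta>. u (t + \<theta>)) \<le> B + Lp_norm p 0 1 (\<lambda>\<theta>. u (0 + \<theta>))" for t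
    using Lp_norm_minkowski[OF p Lp_loc_translation[OF u] Lp_loc_translation[OF u] 0, of t 0] B[of t]
    by (simp add: stepanov_dist_def)
  then show ?thesis unfolding stepanov_bounded_def by (intro conjI u bdd_aboveI2)
qed

lemma stepanov_bounded_diff:
  assumes p: "1 \<le> p" and u: "stepanov_bounded p u" and v: "stepanov_bounded p v"
  shows "bdd_above (range (\<lambda>t. Lp_norm p 0 1 (\<lambda>\<theta>. u (t + \<theta>) - v (t + \<theta>))))"
proof -
  obtain A B where A: "\<And>t. Lp_norm p 0 1 (\<lambda>\<theta>. u (t + \<theta>)) \<le> A" and B: "\<And>t. Lp_norm p 0 1 (\<lambda>\<theta>. v (t + \<theta>)) \<le> B"
    using u v unfolding stepanov_bounded_def bdd_above_def by auto
  have 0: "(\<lambda>_. 0) \<in> Lp_fun p 0 1" by (rule Lp_fun_simple) simp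
  have "Lp_norm p 0 1 (\<lambda>\<theta>. u (t + \<theta>) - v (t + \<theta>)) \<le> A + B" for t
  proof -
    have "Lp_norm p 0 1 (\<lambda>\<theta>. 0 - v (t + \<theta>)) = Lp_norm p 0 1 (\<lambda>\<theta>. v (t + \<theta>))"
      by (simp add: Lp_norm_def)
    then show ?thesis
      using Lp_norm_minkowski[OF p Lp_loc_translation 0 Lp_loc_translation, of u v t t] u v A[of t] B[of t]
      by (simp add: stepanov_bounded_def)
  qed
  then show ?thesis by (rule bdd_aboveI2)
qed

lemma stepanov_bounded_Sp_ap: "1 \<le> p \<Longrightarrow> u \<in> Sp_ap p \<Longrightarrow> stepanov_bounded p u"
  by (intro stepanov_boundedI line_pseudometric.line_ap_bounded line_pseudometric_stepanov_dist)
    (auto simp: Sp_ap_iff)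

lemma stepanov_bounded_Sp_aa: "1 \<le> p \<Longrightarrow> u \<in> Sp_aa p \<Longrightarrow> stepanov_bounded p u"
  by (intro stepanov_boundedI line_pseudometric.line_aa_bounded line_pseudometric_stepanov_dist)
    (auto simp: Sp_aa_iff)

lemma stepanov_bounded_BSp:
  assumes p: "1 \<le> p" and u: "u \<in> BSp p"
  shows "stepanov_bounded p u"
proof (rule stepanov_boundedI[OF p])
  show loc: "u \<in> Lp_loc p" using u by (simp add: BSp_def)
  show "\<exists>B. \<forall>t. stepanov_dist p u t 0 \<le> B"
    using u unfolding BSp_def BC_def Metric_space.mbounded_alt[OF Metric_space_mspace_mdist]
    by (auto simp: mdist_bochner_transform[OF p loc])
qed

lemma AE_lebesgue_translation:
  assumes "AE t in lebesgue. P (t::real)"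
  shows "AE \<theta> in lebesgue_on {a<..<b}. P (t + \<theta>)"
proof (rule AE_interval_translation)
  show "AE x in lebesgue_on {t + a<..<t + b}. P x"
    using assms by (subst AE_restrict_space_iff) (auto elim: eventually_mono)
qed

text \<open>The sections of \<open>f\<close> are assumed only locally integrable, the common ground
  of both statements; their recurrence enters in \<open>nemytskii_Sp_aa\<close> and
  \<open>nemytskii_Sp_ap\<close>.\<close>

locale stepanov_nemytskii =
  fixes p q r :: real and L :: "real \<Rightarrow> real" and f :: "real \<times> 'x::banach \<Rightarrow> 'y::banach"
  assumes exps: "1 \<le> p" "1 \<le> q" "1 \<le> r" "1 / q = 1 / p + 1 / r"
    and L: "L \<in> BSp r"
    and lip: "AE t in lebesgue. \<forall>x1 x2. norm (f (t, x1) - f (t, x2)) \<le> L t * norm (x1 - x2)"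
    and f: "\<And>x. (\<lambda>t. f (t, x)) \<in> Lp_loc q"
begin

lemma superposition: "Lp_superposition p q r a b (\<lambda>\<theta>. L (t + \<theta>)) (\<lambda>\<theta> x. f (t + \<theta>, x))"
proof
  show "(\<lambda>\<theta>. L (t + \<theta>)) \<in> Lp_fun r a b" using L by (intro Lp_loc_translation) (simp add: BSp_def)
  show "AE \<theta> in lebesgue_on {a<..<b}.
      \<forall>x y. norm (f (t + \<theta>, x) - f (t + \<theta>, y)) \<le> L (t + \<theta>) * norm (x - y)"
    by (rule AE_lebesgue_translation[OF lip])
  show "(\<lambda>\<theta>. f (t + \<theta>, x)) \<in> Lp_fun q a b" for x by (rule Lp_loc_translation[OF f])
qed (fact exps)+

lemma Lipschitz_bound: obtains K where "0 < K" "\<And>t. Lp_norm r 0 1 (\<lambda>\<theta>. L (t + \<theta>)) \<le> K"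
proof -
  obtain K where K: "\<And>t. Lp_norm r 0 1 (\<lambda>\<theta>. L (t + \<theta>)) \<le> K"
    using stepanov_bounded_BSp[OF exps(3) L] unfolding stepanov_bounded_def bdd_above_def by auto
  \<comment> \<open>The maximum makes the bound positive; it will serve as a denominator.\<close>
  have "Lp_norm r 0 1 (\<lambda>\<theta>. L (t + \<theta>)) \<le> max 1 K" for t using K[of t] by simp
  then show thesis by (intro that[of "max 1 K"]) auto
qed

lemma nemytskii_Lp_loc:
  assumes u: "u \<in> Lp_loc p"
  shows "nemytskii f u \<in> Lp_loc q"
  using Lp_superposition.Lp_fun_superposition[OF superposition[where t = 0], of u] u
  by (simp add: Lp_loc_def nemytskii_def)

text \<open>The simple function belongs to the base point, so the windows at \<open>a\<close> and at
  \<open>b\<close> are compared with the same \<open>\<phi>\<close>, and in between only the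
  sections of \<open>f\<close> at the values of \<open>\<phi>\<close> change.\<close>

lemma controlled_nemytskii:
  assumes u: "u \<in> Lp_loc p"
  shows "controlled_line (stepanov_dist p u) (\<lambda>x. stepanov_dist q (\<lambda>t. f (t, x)))
    (stepanov_dist q (nemytskii f u))"
proof -
  note pm = line_pseudometric_stepanov_dist
  show ?thesis
  proof (intro controlled_line.intro controlled_line_axioms.intro)
    show "line_pseudometric (stepanov_dist p u)" using pm[OF exps(1) u] .
    show "line_pseudometric (stepanov_dist q (nemytskii f u))"
      using pm[OF exps(2) nemytskii_Lp_loc[OF u]] .
    show "line_pseudometric (stepanov_dist q (\<lambda>t. f (t, x)))" for x using pm[OF exps(2) f] .
    fix e :: real assume e: "0 < e"
    obtain K where K: "0 < K" "\<And>t. Lp_norm r 0 1 (\<lambda>\<theta>. L (t + \<theta>)) \<le> K" using Lipschitz_bound by blast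
    \<comment> \<open>A window within \<open>\<eta>\<close> of the one at \<open>c\<close> is within
      \<open>2 * \<eta>\<close> of \<open>\<phi>\<close>, and Hoelder's inequality turns this into
      \<open>2 * K * \<eta> = e / 4\<close>, once for \<open>a\<close> and once for
      \<open>b\<close>.\<close>
    define \<eta> where "\<eta> = e / (8 * K)"
    have \<eta>: "0 < \<eta>" using e K(1) by (simp add: \<eta>_def)
    have u01: "(\<lambda>\<theta>. u (t + \<theta>)) \<in> Lp_fun p 0 1" for t by (rule Lp_loc_translation[OF u])
    show "\<exists>\<eta>>0. \<forall>c. \<exists>D \<delta>. finite D \<and> 0 < \<delta> \<and>
      (\<forall>a b. stepanov_dist p u a c < \<eta> \<longrightarrow> stepanov_dist p u b c < \<eta> \<longrightarrow>
        (\<forall>x\<in>D. stepanov_dist q (\<lambda>t. f (t, x)) a b < \<delta>) \<longrightarrow> stepanov_dist q (nemytskii f u) a b < e)"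
    proof (rule exI[of _ \<eta>], intro conjI allI \<eta>)
      fix c
      obtain \<phi> where \<phi>: "simple_function (lebesgue_on {0<..<1}) \<phi>"
          "Lp_norm p 0 1 (\<lambda>\<theta>. u (c + \<theta>) - \<phi> \<theta>) < \<eta>"
        using Lp_simple_approx[OF exps(1) u01 \<eta>] .
      have \<phi>p: "\<phi> \<in> Lp_fun p 0 1" by (rule Lp_fun_simple[OF \<phi>(1)])
      have fin: "finite (\<phi> ` {0<..<1})" using simple_functionD(1)[OF \<phi>(1)] by simp
      define n where "n = real (card (\<phi> ` {0<..<1})) + 1"
      \<comment> \<open>\<open>n\<close> is the factor lost in
        \<open>Lp_norm_superposition_simple_diff\<close>; the middle comparison may cost the
        remaining \<open>e / 2\<close>.\<close>
      define \<delta> where "\<delta> = e / (2 * n)"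
      have n: "0 < n" by (simp add: n_def add_nonneg_pos)
      then have \<delta>: "0 < \<delta>" "n * \<delta> = e / 2" using e by (simp_all add: \<delta>_def)
      let ?W = "\<lambda>t \<theta>. f (t + \<theta>, u (t + \<theta>))" and ?G = "\<lambda>t \<theta>. f (t + \<theta>, \<phi> \<theta>)"
      have W: "?W t \<in> Lp_fun q 0 1" and G: "?G t \<in> Lp_fun q 0 1" for t
        using Lp_superposition.Lp_fun_superposition[OF superposition] u01 \<phi>p by blast+
      have near: "Lp_norm q 0 1 (\<lambda>\<theta>. ?W t \<theta> - ?G t \<theta>) < e / 4" if t: "stepanov_dist p u t c < \<eta>" for t
      proof -
        have "Lp_norm p 0 1 (\<lambda>\<theta>. u (t + \<theta>) - \<phi> \<theta>) < 2 * \<eta>"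
          using Lp_norm_minkowski[OF exps(1) u01[of t] u01[of c] \<phi>p] t \<phi>(2) by (simp add: stepanov_dist_def)
        then have "K * Lp_norm p 0 1 (\<lambda>\<theta>. u (t + \<theta>) - \<phi> \<theta>) < e / 4"
          using K(1) by (simp add: \<eta>_def field_simps)
        moreover have "Lp_norm q 0 1 (\<lambda>\<theta>. ?W t \<theta> - ?G t \<theta>) \<le>
            Lp_norm r 0 1 (\<lambda>\<theta>. L (t + \<theta>)) * Lp_norm p 0 1 (\<lambda>\<theta>. u (t + \<theta>) - \<phi> \<theta>)"
          by (rule Lp_superposition.Lp_norm_superposition_diff[OF superposition u01 \<phi>p])
        moreover have "\<dots> \<le> K * Lp_norm p 0 1 (\<lambda>\<theta>. u (t + \<theta>) - \<phi> \<theta>)"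
          by (intro mult_right_mono K(2) Lp_norm_nonneg)
        ultimately show ?thesis by linarith
      qed
      have "stepanov_dist q (nemytskii f u) a b < e"
        if a: "stepanov_dist p u a c < \<eta>" and b: "stepanov_dist p u b c < \<eta>"
          and ab: "\<And>x. x \<in> \<phi> ` {0<..<1} \<Longrightarrow> stepanov_dist q (\<lambda>t. f (t, x)) a b < \<delta>" for a b
      proof -
        have "Lp_norm q 0 1 (\<lambda>\<theta>. ?G a \<theta> - ?G b \<theta>) \<le> (real (card (\<phi> ` {0<..<1})) + 1) * \<delta>"
          using ab by (intro Lp_norm_superposition_simple_diff[where g = "\<lambda>\<theta> x. f (a + \<theta>, x)"
                and h = "\<lambda>\<theta> x. f (b + \<theta>, x)"] exps(2) Lp_loc_translation[OF f] fin
              Lp_fun_diff[OF exps(2)] G \<delta>(1)) (simp add: stepanov_dist_def)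
        then have "Lp_norm q 0 1 (\<lambda>\<theta>. ?G a \<theta> - ?G b \<theta>) \<le> e / 2" using \<delta>(2) by (simp add: n_def)
        moreover have "Lp_norm q 0 1 (\<lambda>\<theta>. ?G b \<theta> - ?W b \<theta>) < e / 4"
          using near[OF b] by (simp add: Lp_norm_def norm_minus_commute)
        moreover have "Lp_norm q 0 1 (\<lambda>\<theta>. ?W a \<theta> - ?W b \<theta>) \<le> Lp_norm q 0 1 (\<lambda>\<theta>. ?W a \<theta> - ?G a \<theta>) +
            (Lp_norm q 0 1 (\<lambda>\<theta>. ?G a \<theta> - ?G b \<theta>) + Lp_norm q 0 1 (\<lambda>\<theta>. ?G b \<theta> - ?W b \<theta>))"
          using Lp_norm_minkowski[OF exps(2) W[of a] G[of a] W[of b]]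
            Lp_norm_minkowski[OF exps(2) G[of a] G[of b] W[of b]] by linarith
        ultimately show ?thesis
          using near[OF a] by (simp add: stepanov_dist_def nemytskii_def)
      qed
      then show "\<exists>D \<delta>. finite D \<and> 0 < \<delta> \<and>
        (\<forall>a b. stepanov_dist p u a c < \<eta> \<longrightarrow> stepanov_dist p u b c < \<eta> \<longrightarrow>
          (\<forall>x\<in>D. stepanov_dist q (\<lambda>t. f (t, x)) a b < \<delta>) \<longrightarrow> stepanov_dist q (nemytskii f u) a b < e)"
        using fin \<delta>(1) by (intro exI[of _ "\<phi> ` {0<..<1}"] exI[of _ \<delta>]) blast
    qed
  qed
qed

lemma nemytskii_Sp_aa:
  assumes "\<And>x. (\<lambda>t. f (t, x)) \<in> Sp_aa q" "u \<in> Sp_aa p"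
  shows "nemytskii f u \<in> Sp_aa q"
  using assms controlled_line.line_aa_W[OF controlled_nemytskii] nemytskii_Lp_loc
  by (simp add: Sp_aa_iff exps)

lemma nemytskii_Sp_ap:
  assumes "\<And>x. (\<lambda>t. f (t, x)) \<in> Sp_ap q" "u \<in> Sp_ap p"
  shows "nemytskii f u \<in> Sp_ap q"
  using assms controlled_line.line_ap_W[OF controlled_nemytskii] nemytskii_Lp_loc
  by (simp add: Sp_ap_iff exps)

lemma nemytskii_continuous:
  assumes U: "\<And>u. u \<in> U \<Longrightarrow> stepanov_bounded p u"
  shows "Sp_continuous_on p q U (nemytskii f)"
proof -
  obtain K where K: "0 < K" "\<And>t. Lp_norm r 0 1 (\<lambda>\<theta>. L (t + \<theta>)) \<le> K" using Lipschitz_bound by blast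
  have le: "Sp_norm q (\<lambda>t. nemytskii f v t - nemytskii f u t) \<le> K * Sp_norm p (\<lambda>t. v t - u t)"
    if u: "u \<in> U" and v: "v \<in> U" for u v
    unfolding Sp_norm_def[of q]
  proof (rule cSUP_least)
    fix t
    have "(\<lambda>\<theta>. u (t + \<theta>)) \<in> Lp_fun p 0 1" "(\<lambda>\<theta>. v (t + \<theta>)) \<in> Lp_fun p 0 1"
      using U u v by (auto simp: stepanov_bounded_def intro: Lp_loc_translation)
    then have "Lp_norm q 0 1 (\<lambda>\<theta>. nemytskii f v (t + \<theta>) - nemytskii f u (t + \<theta>)) \<le>
        Lp_norm r 0 1 (\<lambda>\<theta>. L (t + \<theta>)) * Lp_norm p 0 1 (\<lambda>\<theta>. v (t + \<theta>) - u (t + \<theta>))"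
      unfolding nemytskii_def by (intro Lp_superposition.Lp_norm_superposition_diff[OF superposition])
    \<comment> \<open>Boundedness of \<open>u\<close> and \<open>v\<close> enters here: it lets the
      supremum of their difference dominate its value at \<open>t\<close>.\<close>
    also have "\<dots> \<le> K * Sp_norm p (\<lambda>t. v t - u t)"
      unfolding Sp_norm_def using stepanov_bounded_diff[OF exps(1) U[OF v] U[OF u]] K
      by (intro mult_mono cSUP_upper) (auto simp: Lp_norm_nonneg)
    finally show "Lp_norm q 0 1 (\<lambda>\<theta>. nemytskii f v (t + \<theta>) - nemytskii f u (t + \<theta>)) \<le>
        K * Sp_norm p (\<lambda>t. v t - u t)" .
  qed simp
  show ?thesis
    unfolding Sp_continuous_on_def
  proof (intro ballI allI impI)
    fix u and e :: real assume u: "u \<in> U" and e: "0 < e"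
    have "Sp_norm q (\<lambda>t. nemytskii f v t - nemytskii f u t) < e"
      if "v \<in> U" "Sp_norm p (\<lambda>t. v t - u t) < e / K" for v
      using le[OF u that(1)] that(2) K(1) by (simp add: field_simps)
    then show "\<exists>\<delta>>0. \<forall>v\<in>U. Sp_norm p (\<lambda>t. v t - u t) < \<delta> \<longrightarrow>
        Sp_norm q (\<lambda>t. nemytskii f v t - nemytskii f u t) < e"
      using e K(1) by (intro exI[of _ "e / K"]) auto
  qed
qed

end

theorem corollary4p3:
  fixes f :: "real \<times> 'x::banach \<Rightarrow> 'y::banach"
    and p q r :: real
    and L :: "real \<Rightarrow> real"
  assumes "1 \<le> p" and "1 \<le> q" and "1 \<le> r"
    and "1 / q = 1 / p + 1 / r"
    and "L \<in> BSp r"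
    and "AE t in lebesgue. \<forall>x1 x2. norm (f (t, x1) - f (t, x2)) \<le> L t * norm (x1 - x2)"
  shows "((\<forall>x. (\<lambda>t. f (t, x)) \<in> Sp_aa q) \<longrightarrow>
            nemytskii f ` Sp_aa p \<subseteq> Sp_aa q \<and>
            Sp_continuous_on p q (Sp_aa p) (nemytskii f))
       \<and> ((\<forall>x. (\<lambda>t. f (t, x)) \<in> Sp_ap q) \<longrightarrow>
            nemytskii f ` Sp_ap p \<subseteq> Sp_ap q \<and>
            Sp_continuous_on p q (Sp_ap p) (nemytskii f))"
proof (intro conjI impI)
  have loc: "stepanov_nemytskii p q r L f" if "\<forall>x. (\<lambda>t. f (t, x)) \<in> Lp_loc q"
    using assms that by (intro stepanov_nemytskii.intro) auto
  {
    assume F: "\<forall>x. (\<lambda>t. f (t, x)) \<in> Sp_aa q"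
    then interpret stepanov_nemytskii p q r L f by (intro loc) (auto simp: Sp_aa_def)
    show "nemytskii f ` Sp_aa p \<subseteq> Sp_aa q" using F nemytskii_Sp_aa by blast
    show "Sp_continuous_on p q (Sp_aa p) (nemytskii f)"
      by (intro nemytskii_continuous stepanov_bounded_Sp_aa assms(1))
  next
    assume F: "\<forall>x. (\<lambda>t. f (t, x)) \<in> Sp_ap q"
    then interpret stepanov_nemytskii p q r L f by (intro loc) (auto simp: Sp_ap_def)
    show "nemytskii f ` Sp_ap p \<subseteq> Sp_ap q" using F nemytskii_Sp_ap by blast
    show "Sp_continuous_on p q (Sp_ap p) (nemytskii f)"
      by (intro nemytskii_continuous stepanov_bounded_Sp_ap assms(1))
  }
qed

end
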